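(* For all $\tilde\alpha,\tilde\beta\in\widetilde{PSL_2\mathbb R}$, with images $\alpha,\beta\in PSL_2\mathbb R=\mathrm{Isom}^+\mathbb H^2$, Milnor's angle function $\Theta$ satisfies $$\Theta(\tilde\beta\tilde\alpha)=\Theta(\tilde\beta)+\Theta(\tilde\alpha)-\tfrac12\,\Delta[i,\beta i,\beta\alpha i],$$ where $i=\sqrt{-1}$ in the upper half plane, and hence $$\left|\Theta(\tilde\beta\tilde\alpha)-\Theta(\tilde\beta)-\Theta(\tilde\alpha)\right|<\frac{\pi}{2}.$$
   Context: $\mathbb H^2$ is the upper half plane model of the hyperbolic plane (curvature $-1$), with its standard orientation, on which $SL_2\mathbb R$ acts by fractional linear transformations; $PSL_2\mathbb R=\mathrm{Isom}^+\mathbb H^2$. $\widetilde{PSL_2\mathbb R}=\widetilde{SL_2\mathbb R}$ is the universal covering group. Milnor's angle function $\Theta:\widetilde{PSL_2\mathbb R}\to\mathbb R$: every $\alpha\in SL_2\mathbb R$ is uniquely $\alpha=R(\alpha)S(\alpha)$ with $R(\alpha)\in SO_2\mathbb R$ and $S(\alpha)$ symmetric positive definite. The retraction $R:SL_2\mathbb R\to SO_2\mathbb R$ lifts to a retraction $\tilde R:\widetilde{SL_2\mathbb R}\to\widetilde{SO_2\mathbb R}$. The map $\exp:\mathbb R\to SO_2\mathbb R$, $\theta\mapsto\begin{pmatrix}\cos\theta&\sin\theta\\-\sin\theta&\cos\theta\end{pmatrix}$ lifts to an isomorphism $\widetilde{\exp}:\mathbb R\to\widetilde{SO_2\mathbb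 R}\subset\widetilde{SL_2\mathbb R}$. Then $\Theta(\tilde\alpha)=\widetilde{\exp}^{-1}(\tilde R(\tilde\alpha))$. Equivalently, $\Theta$ is the unique continuous function with $\Theta(1)=0$ such that $\exp(\Theta(\tilde\alpha))=R(\alpha)$ where $\alpha\in SL_2\mathbb R$ is the image of $\tilde\alpha$. $\Delta[A,B,C]$ is the signed hyperbolic area of the geodesic triangle with ordered vertices $A,B,C\in\mathbb H^2$: positive if $A\to B\to C$ is anticlockwise, negative if clockwise, $0$ if degenerate (collinear or coincident vertices). *)

theory Defs
  imports "HOL-Analysis.Analysis" "HOL-Algebra.Group"
begin

section \<open>The universal covering group of \<open>SL\<^sub>2(\<real>)\<close>\<close>

definition SL2R :: "(real^2^2) monoid" where
  "SL2R = \<lparr>carrier = {A. det A = 1}, monoid.mult = (**), one = mat 1\<rparr>"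

text \<open>The universal covering group is taken up to isomorphism: it is any simply connected
  topological group \<open>G\<close> with a covering homomorphism \<open>p\<close> onto \<open>SL\<^sub>2(\<real>)\<close>.  As \<open>SL\<^sub>2(\<real>)\<close> is a
  double cover of \<open>PSL\<^sub>2(\<real>)\<close>, the same \<open>G\<close> is the universal covering group of \<open>PSL\<^sub>2(\<real>)\<close>.  The
  library's \<open>simply_connected\<close> includes path-connectedness.\<close>

locale universal_cover_SL2R = group G
  for G :: "('g::topological_space, 'm) monoid_scheme" (structure) +
  fixes p :: "'g \<Rightarrow> real^2^2"
  assumes continuous_mult: "continuous_on (carrier G \<times> carrier G) (\<lambda>(x, y). x \<otimes> y)"
    and continuous_inv: "continuous_on (carrier G) (\<lambda>x. inv x)"
    and simply_connected: "simply_connected (carrier G)"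
    and hom: "p \<in> hom G SL2R"
    and covering: "covering_space (carrier G) p (carrier SL2R)"

section \<open>Milnor's angle function\<close>

definition rot :: "real \<Rightarrow> real^2^2" where
  "rot \<theta> = vector [vector [cos \<theta>, sin \<theta>], vector [- sin \<theta>, cos \<theta>]]"

definition sym_pos_def :: "real^2^2 \<Rightarrow> bool" where
  "sym_pos_def S \<longleftrightarrow> transpose S = S \<and> (\<forall>x. x \<noteq> 0 \<longrightarrow> x \<bullet> (S *v x) > 0)"

text \<open>The orthogonal factor of the polar decomposition \<open>A = R S\<close>, with \<open>R\<close> in \<open>SO\<^sub>2(\<real>)\<close>.\<close>

definition rotation_part :: "real^2^2 \<Rightarrow> real^2^2" where
  "rotation_part A = (THE R. rotation_matrix R \<and> (\<exists>S. sym_pos_def S \<and> A = R ** S))"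

text \<open>Membership in \<open>extensional\<close> only fixes the values outside the group, without which the
  function would not be unique.\<close>

definition milnor_angle ::
    "('g::topological_space, 'm) monoid_scheme \<Rightarrow> ('g \<Rightarrow> real^2^2) \<Rightarrow> 'g \<Rightarrow> real" where
  "milnor_angle G p = (THE \<Theta>. \<Theta> \<in> extensional (carrier G) \<and> continuous_on (carrier G) \<Theta> \<and>
     \<Theta> \<one>\<^bsub>G\<^esub> = 0 \<and> (\<forall>x \<in> carrier G. rot (\<Theta> x) = rotation_part (p x)))"

section \<open>The hyperbolic plane\<close>

definition upper_half_plane :: "complex set" where
  "upper_half_plane = {z. Im z > 0}"

text \<open>The image in \<open>PSL\<^sub>2(\<real>)\<close> of a matrix in \<open>SL\<^sub>2(\<real>)\<close>, regarded as an isometry of the upper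
  half plane, is the fractional linear transformation that it induces.\<close>

definition mobius :: "real^2^2 \<Rightarrow> complex \<Rightarrow> complex" where
  "mobius A = moebius (of_real (A$1$1)) (of_real (A$1$2)) (of_real (A$2$1)) (of_real (A$2$2))"

definition hdist :: "complex \<Rightarrow> complex \<Rightarrow> real" where
  "hdist z w = arcosh (1 + (cmod (z - w))\<^sup>2 / (2 * Im z * Im w))"

definition hsegment :: "complex \<Rightarrow> complex \<Rightarrow> complex set" where
  "hsegment A B = {X \<in> upper_half_plane. hdist A X + hdist X B = hdist A B}"

definition hconvex :: "complex set \<Rightarrow> bool" where
  "hconvex K \<longleftrightarrow> K \<subseteq> upper_half_plane \<and> (\<forall>A \<in> K. \<forall>B \<in> K. hsegment A B \<subseteq> K)"

definition htriangle :: "complex \<Rightarrow> complex \<Rightarrow> complex \<Rightarrow> complex set" where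
  "htriangle A B C = hconvex hull {A, B, C}"

definition harea :: "complex set \<Rightarrow> real" where
  "harea T = (LINT z:T|lborel. 1 / (Im z)\<^sup>2)"

text \<open>The Cayley transform \<open>z \<mapsto> (z - A) / (z - cnj A)\<close> is an orientation-preserving isometry onto
  the Poincare disc that takes \<open>A\<close> to \<open>0\<close> and hence the geodesic rays from \<open>A\<close> to Euclidean radii.
  So \<open>A, B, C\<close> is anticlockwise, clockwise or collinear according to whether the plane vectors to
  the images of \<open>B\<close> and \<open>C\<close> have positive, negative or zero determinant.  The value is
  \<open>1\<close>, \<open>-1\<close> or \<open>0\<close> respectively.\<close>

definition horientation :: "complex \<Rightarrow> complex \<Rightarrow> complex \<Rightarrow> real" where
  "horientation A B C =
     (let c = (\<lambda>z. (z - A) / (z - cnj A)) in sgn (Re (c B) * Im (c C) - Im (c B) * Re (c C)))"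

definition signed_area :: "complex \<Rightarrow> complex \<Rightarrow> complex \<Rightarrow> real" where
  "signed_area A B C = horientation A B C * harea (htriangle A B C)"

end

theory Submission
  imports Defs
begin

text \<open>Both sides of the formula are computed from one function of two points,
  \<open>edge_angle z w = arctan ((Re w - Re z) / (Im z + Im w))\<close>, which is half the signed hyperbolic
  area of the region above the geodesic from \<open>z\<close> to \<open>w\<close>.

  On the area side, the substitution \<open>(x, y) \<mapsto> (x, x\<^sup>2 + y\<^sup>2)\<close> carries the half plane onto the
  region above a parabola and geodesics onto straight segments, so that a hyperbolic triangle
  becomes a Euclidean one (\<open>hconvex_hull_klein\<close>).  Cutting along vertical lines shows that, up to
  null sets, the triangle is the difference of the regions above its lower and its upper sides.
  The region above one side has area \<open>2 * edge_angle\<close> by the fundamental theorem of calculus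
  (\<open>nn_integral_above_arc\<close>), so the signed area of a triangle is twice the sum of the edge
  angles around it (\<open>signed_area_eq_edge_sum\<close>), like the shoelace formula.

  On the side of the group, the rotation part of \<open>A\<close> with rows \<open>(a, b)\<close> and \<open>(c, d)\<close> is the direction of the complex number
  \<open>(a + d) + (b - c) \<i>\<close>, whose conjugate is \<open>- \<i> * (c \<i> + d) * (A \<i> + \<i>)\<close>.  As \<open>c z + d\<close> is a
  factor of automorphy, the direction of this number for \<open>B A\<close> differs from the product of the
  directions for \<open>B\<close> and \<open>A\<close> by the three edge angles of the triangle \<open>\<i>, B \<i>, B A \<i>\<close>
  (\<open>sgn_polar_complex_mult\<close>).  Hence the defect of \<open>\<Theta>\<close> and minus the sum of the edge angles agree
  modulo \<open>2 * pi\<close>.  Both lie strictly between \<open>- pi / 2\<close> and \<open>pi / 2\<close>: the edge sum because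
  its cosine is positive and each term is less than \<open>pi / 2\<close> in absolute value, the defect because
  it is continuous, vanishes at the identity, and has positive cosine everywhere.  So they are
  equal, and the bound comes for free.

  The function \<open>\<Theta>\<close> exists because a nowhere vanishing continuous function on a simply connected,
  locally path-connected space has a continuous logarithm.  Here this is needed for an arbitrary
  topological space (\<open>continuous_logarithm_on_simply_connected_space\<close>), since the covering
  group is not assumed to be metrizable.\<close>

section \<open>Logarithms on simply connected spaces\<close>

text \<open>Local path-connectedness is pulled back through the sheets, on which \<open>p\<close> is a homeomorphism
  onto an open subset of the base.\<close>

lemma locally_path_connected_covering_space:
  assumes cov: "covering_space C p S" and S: "locally path_connected S"
  shows "locally path_connected C"
proof (rule locallyI)
  fix W x
  assume W: "openin (top_of_set C) W" and x: "x \<in> W"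
  have WC: "W \<subseteq> C" using W openin_imp_subset by blast
  obtain T u q where T: "x \<in> T" "openin (top_of_set C) T" and u: "p x \<in> u" "openin (top_of_set S) u"
    and q: "homeomorphism T u p q"
    using covering_space_local_homeomorphism[OF cov] x WC by (metis subsetD)
  have TC: "T \<subseteq> C" using T openin_imp_subset by blast
  have q': "continuous_on u q" "q ` u = T" "p ` T = u" "continuous_on T p"
    "\<And>y. y \<in> u \<Longrightarrow> p (q y) = y" "\<And>y. y \<in> T \<Longrightarrow> q (p y) = y"
    using q unfolding homeomorphism_def by auto
  define W' where "W' = u \<inter> q -` (W \<inter> T)"
  have "openin (top_of_set T) (W \<inter> T)"
    by (metis Int_lower2 T(2) TC W openin_Int openin_subset_trans)
  then have "openin (top_of_set u) W'"
    unfolding W'_def using q'(1,2) by (intro continuous_openin_preimage) auto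
  then have "openin (top_of_set S) W'"
    using u(2) openin_trans by blast
  moreover have "p x \<in> W'"
    using u T x q' by (auto simp: W'_def)
  ultimately obtain U V where UV: "openin (top_of_set S) U" "path_connected V" "p x \<in> U" "U \<subseteq> V" "V \<subseteq> W'"
    using locallyE[OF S] by metis
  have Uu: "U \<subseteq> u" using UV by (auto simp: W'_def)
  have "openin (top_of_set u) U"
    by (metis UV(1) Uu openin_imp_subset openin_subset_trans u(2))
  then have "openin (top_of_set T) (T \<inter> p -` U)"
    using q' by (intro continuous_openin_preimage) auto
  then have 1: "openin (top_of_set C) (T \<inter> p -` U)"
    using T(2) openin_trans by blast
  have 2: "path_connected (q ` V)"
    using UV q'(1) by (intro path_connected_continuous_image) (auto intro: continuous_on_subset simp: W'_def)
  have 3: "T \<inter> p -` U \<subseteq> q ` V"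
    using UV q'(6) by force
  have 4: "q ` V \<subseteq> W" using UV by (auto simp: W'_def)
  show "\<exists>U V. openin (top_of_set C) U \<and> path_connected V \<and> x \<in> U \<and> U \<subseteq> V \<and> V \<subseteq> W"
    using 1 2 3 4 T(1) UV(3) by blast
qed

text \<open>A free homotopy between two constant loops moves their common base point along a path.\<close>

lemma path_connected_if_simply_connected:
  fixes S :: "'a::topological_space set"
  assumes S: "simply_connected S" and "x \<in> S" "y \<in> S"
  obtains \<gamma> where "path \<gamma>" "path_image \<gamma> \<subseteq> S" "pathstart \<gamma> = x" "pathfinish \<gamma> = y"
proof -
  have "homotopic_loops S (\<lambda>_. x) (\<lambda>_. y)"
    using assms(2,3) by (intro S[unfolded simply_connected_def, rule_format])
      (auto simp: path_def pathfinish_def pathstart_def path_image_def)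
  then obtain k where k: "continuous_on ({0..1::real} \<times> {0..1::real}) k" "k \<in> ({0..1} \<times> {0..1}) \<rightarrow> S"
      "\<And>t. t \<in> {0..1} \<Longrightarrow> k (0,t) = x" "\<And>t. t \<in> {0..1} \<Longrightarrow> k (1,t) = y"
    unfolding homotopic_loops by (auto simp: image_subset_iff_funcset)
  show ?thesis
  proof
    let ?\<gamma> = "\<lambda>t::real. k (t,0)"
    show "path ?\<gamma>" "path_image ?\<gamma> \<subseteq> S" "pathstart ?\<gamma> = x" "pathfinish ?\<gamma> = y"
      unfolding path_def path_image_def pathstart_def pathfinish_def using k
      by (auto intro!: continuous_intros continuous_on_compose2[OF k(1)])
  qed
qed

text \<open>Monodromy: a loop contracts in \<open>S\<close>, hence its image contracts in the punctured plane, where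
  lifts of homotopic paths through \<open>exp\<close> with the same start have the same end.\<close>

lemma lift_of_loop_closed:
  fixes S :: "'a::topological_space set" and f :: "'a \<Rightarrow> complex"
  assumes S: "simply_connected S" and f: "continuous_on S f" "\<And>x. x \<in> S \<Longrightarrow> f x \<noteq> 0"
    and \<gamma>: "path \<gamma>" "path_image \<gamma> \<subseteq> S" "pathfinish \<gamma> = pathstart \<gamma>"
    and h: "path h" "\<And>t. t \<in> {0..1} \<Longrightarrow> exp (h t) = f (\<gamma> t)"
  shows "pathfinish h = pathstart h"
proof -
  define a where "a = pathstart \<gamma>"
  have a: "a \<in> S" using \<gamma> unfolding a_def by (auto simp: path_image_def pathstart_def)
  have "homotopic_loops S \<gamma> (\<lambda>_. a)"
    using \<gamma> a by (intro S[unfolded simply_connected_def, rule_format])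
      (auto simp: path_def pathfinish_def pathstart_def path_image_def)
  then have "homotopic_loops (-{0}) (f \<circ> \<gamma>) (f \<circ> (\<lambda>_. a))"
    by (rule homotopic_loops_continuous_image[OF _ f(1)]) (use f(2) in auto)
  then have "homotopic_loops (-{0}) (f \<circ> \<gamma>) (linepath (f a) (f a))"
    by (simp add: o_def linepath_refl)
  then have hp: "homotopic_paths (-{0}) (f \<circ> \<gamma>) (linepath (f a) (f a))"
    by (auto dest!: homotopic_loops_imp_homotopic_paths_null simp: pathstart_def a_def)
  have ha: "exp (pathstart h) = f a"
    using h(2)[of 0] by (simp add: a_def pathstart_def)
  show ?thesis
  proof (rule trans[OF covering_space_monodromy[OF covering_space_exp_punctured_plane, where ?h2.0="\<lambda>_. pathstart h"]])
    show "path (f \<circ> \<gamma>)"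
      by (rule path_continuous_image[OF \<gamma>(1)]) (rule continuous_on_subset[OF f(1) \<gamma>(2)])
    show "path_image (f \<circ> \<gamma>) \<subseteq> - {0}"
      using \<gamma>(2) f(2) by (auto simp: path_image_def)
    show "homotopic_paths (- {0}) (f \<circ> \<gamma>) (linepath (f a) (f a))" by (rule hp)
  qed (use h ha a f(2) in \<open>auto simp: pathstart_def pathfinish_def path_def linepath_refl\<close>)
qed

text \<open>The logarithm at \<open>y\<close> is the end point of the lift through \<open>exp\<close> of the image of a path from a
  base point to \<open>y\<close>.  By monodromy the path does not matter, and near a point \<open>x\<close> it may be chosen
  to run through \<open>x\<close> and then inside a neighbourhood where \<open>f y / f x\<close> stays in the slit plane;
  there the logarithm differs from a constant by \<open>Ln (f y / f x)\<close>, which is continuous.\<close>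

lemma continuous_logarithm_on_simply_connected_space:
  fixes S :: "'a::topological_space set" and f :: "'a \<Rightarrow> complex"
  assumes S: "simply_connected S" "locally path_connected S"
    and f: "continuous_on S f" "\<And>x. x \<in> S \<Longrightarrow> f x \<noteq> 0"
  obtains g where "continuous_on S g" "\<And>x. x \<in> S \<Longrightarrow> exp (g x) = f x"
proof (cases "S = {}")
  case True
  then show ?thesis using that by simp
next
  case False
  then obtain z where z: "z \<in> S" by auto
  define L where "L = (\<lambda>y v. \<exists>\<gamma> h. path \<gamma> \<and> path_image \<gamma> \<subseteq> S \<and> pathstart \<gamma> = z \<and> pathfinish \<gamma> = y \<and>
     path h \<and> (\<forall>t\<in>{0..1}. exp (h t) = f (\<gamma> t)) \<and> pathstart h = Ln (f z) \<and> pathfinish h = (v::complex))"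
  have exp_L: "exp v = f y" if "L y v" for y v
    using that unfolding L_def by (auto simp: pathfinish_def)
  have L_ex: "\<exists>v. L y v" if y: "y \<in> S" for y
  proof -
    obtain \<gamma> where \<gamma>: "path \<gamma>" "path_image \<gamma> \<subseteq> S" "pathstart \<gamma> = z" "pathfinish \<gamma> = y"
      using path_connected_if_simply_connected[OF S(1) z y] .
    have "path (f \<circ> \<gamma>)"
      by (rule path_continuous_image[OF \<gamma>(1)]) (rule continuous_on_subset[OF f(1) \<gamma>(2)])
    moreover have "path_image (f \<circ> \<gamma>) \<subseteq> - {0}"
      using \<gamma>(2) f(2) by (auto simp: path_image_def)
    moreover have "pathstart (f \<circ> \<gamma>) = exp (Ln (f z))"
      using f(2)[OF z] \<gamma>(3) by (simp add: pathstart_def)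
    ultimately obtain h where "path h" "pathstart h = Ln (f z)" "\<And>t. t \<in> {0..1} \<Longrightarrow> exp (h t) = (f \<circ> \<gamma>) t"
      using covering_space_lift_path_strong[OF covering_space_exp_punctured_plane, of "Ln (f z)" "f \<circ> \<gamma>"]
      by (metis UNIV_I)
    then have "L y (pathfinish h)"
      unfolding L_def using \<gamma> by (intro exI[of _ \<gamma>] exI[of _ h]) auto
    then show ?thesis by blast
  qed
  have L_uniq: "v = w" if "L y v" "L y w" for y v w
  proof -
    obtain \<gamma> h where 1: "path \<gamma>" "path_image \<gamma> \<subseteq> S" "pathstart \<gamma> = z" "pathfinish \<gamma> = y"
       "path h" "\<And>t. t\<in>{0..1} \<Longrightarrow> exp (h t) = f (\<gamma> t)" "pathstart h = Ln (f z)" "pathfinish h = v"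
      using \<open>L y v\<close> unfolding L_def by blast
    obtain \<delta> k where 2: "path \<delta>" "path_image \<delta> \<subseteq> S" "pathstart \<delta> = z" "pathfinish \<delta> = y"
       "path k" "\<And>t. t\<in>{0..1} \<Longrightarrow> exp (k t) = f (\<delta> t)" "pathstart k = Ln (f z)" "pathfinish k = w"
      using \<open>L y w\<close> unfolding L_def by blast
    \<comment> \<open>The shift makes the reversed second lift start where the first lift ends.\<close>
    define k' where "k' = (\<lambda>t. k t + (v - w))"
    have k': "path k'" "pathfinish k' = v" "pathstart k' = Ln (f z) + (v - w)"
      using 2 unfolding k'_def path_def pathstart_def pathfinish_def by (auto intro!: continuous_intros)
    have fy: "exp (v - w) = 1"
      using exp_L[OF that(1)] exp_L[OF that(2)] exp_not_eq_zero[of v] by (simp add: exp_diff)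
    have ek': "exp (k' t) = f (\<delta> t)" if "t \<in> {0..1}" for t
      using 2(6)[OF that] fy by (simp add: k'_def exp_add)
    have "pathfinish (h +++ reversepath k') = pathstart (h +++ reversepath k')"
    proof (rule lift_of_loop_closed[OF S(1) f, where \<gamma> = "\<gamma> +++ reversepath \<delta>"])
      show "exp ((h +++ reversepath k') t) = f ((\<gamma> +++ reversepath \<delta>) t)" if "t \<in> {0..1}" for t
        using that by (auto simp: joinpaths_def reversepath_def intro!: 1(6) ek')
    qed (use 1 2 k' in \<open>auto simp: path_image_join\<close>)
    then show "v = w" using 1 k' by simp
  qed
  define g where "g = (\<lambda>y. THE v. L y v)"
  have g: "L y (g y)" if "y \<in> S" for y
    unfolding g_def using L_ex[OF that] L_uniq by (metis theI)
  have g_eq: "g y = v" if "L y v" for y v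
    unfolding g_def using that L_uniq by blast
  have "continuous_on S g"
    unfolding continuous_on_def
  proof
    fix x assume x: "x \<in> S"
    define r where "r = (\<lambda>y. f y / f x)"
    have r: "continuous_on S r" unfolding r_def using f x by (auto intro!: continuous_intros)
    define W where "W = S \<inter> r -` ball 1 1"
    have "openin (top_of_set S) W" "x \<in> W"
      using r f(2)[OF x] x by (auto simp: W_def r_def intro!: continuous_openin_preimage_gen)
    then obtain U V where UV: "openin (top_of_set S) U" "path_connected V" "x \<in> U" "U \<subseteq> V" "V \<subseteq> W"
      using locallyE[OF S(2)] by metis
    have slit: "r y \<notin> \<real>\<^sub>\<le>\<^sub>0" if "y \<in> W" for y
    proof
      assume "r y \<in> \<real>\<^sub>\<le>\<^sub>0"
      then have "Re (r y) \<le> 0" by (auto simp: complex_nonpos_Reals_iff)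
      moreover have "\<bar>Re (1 - r y)\<bar> < 1"
        using that abs_Re_le_cmod[of "1 - r y"] by (auto simp: W_def dist_norm)
      ultimately show False by simp
    qed
    have VS: "V \<subseteq> S" using UV by (auto simp: W_def)
    have local: "g y = g x + Ln (r y)" if y: "y \<in> U" for y
    proof (rule g_eq)
      obtain \<delta> where \<delta>: "path \<delta>" "path_image \<delta> \<subseteq> V" "pathstart \<delta> = x" "pathfinish \<delta> = y"
        using UV(2-4) y unfolding path_connected_def by blast
      obtain \<gamma> h where 1: "path \<gamma>" "path_image \<gamma> \<subseteq> S" "pathstart \<gamma> = z" "pathfinish \<gamma> = x"
         "path h" "\<And>t. t\<in>{0..1} \<Longrightarrow> exp (h t) = f (\<gamma> t)" "pathstart h = Ln (f z)" "pathfinish h = g x"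
        using g[OF x] unfolding L_def by blast
      define k where "k = (\<lambda>t. g x + Ln (r (\<delta> t)))"
      have \<delta>V: "\<delta> t \<in> V" if "t \<in> {0..1}" for t using \<delta> that by (auto simp: path_image_def)
      have "continuous_on {0..1} (\<lambda>t. r (\<delta> t))"
        using \<delta> VS \<delta>V unfolding path_def by (intro continuous_on_compose2[OF r]) auto
      then have pk: "path k"
        unfolding k_def path_def
      proof (intro continuous_intros continuous_on_Ln)
        fix w assume "w \<in> {0..1::real}"
        then show "r (\<delta> w) \<notin> \<real>\<^sub>\<le>\<^sub>0" using \<delta>V[of w] UV(5) slit by blast
      qed
      have ek: "exp (k t) = f (\<delta> t)" if "t \<in> {0..1}" for t
      proof -
        have "\<delta> t \<in> S" using \<delta>V[OF that] VS by auto
        then show ?thesis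
          using f(2) x exp_L[OF g[OF x]] by (simp add: k_def exp_add r_def)
      qed
      have k0: "pathstart k = g x" "pathfinish k = g x + Ln (r y)"
        using \<delta> f(2)[OF x] by (auto simp: k_def pathstart_def pathfinish_def r_def)
      show "L y (g x + Ln (r y))"
        unfolding L_def
      proof (intro exI[of _ "\<gamma> +++ \<delta>"] exI[of _ "h +++ k"] conjI ballI)
        show "path_image (\<gamma> +++ \<delta>) \<subseteq> S"
          using 1 \<delta> VS by (subst path_image_join) auto
        show "exp ((h +++ k) t) = f ((\<gamma> +++ \<delta>) t)" if "t \<in> {0..1}" for t
          using that by (auto simp: joinpaths_def intro!: 1(6) ek)
      qed (use 1 \<delta> k0 pk in auto)
    qed
    have "continuous_on U (\<lambda>y. g x + Ln (r y))"
      using UV slit VS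
      by (intro continuous_intros continuous_on_Ln continuous_on_subset[OF r]) auto
    then have "continuous_on U g"
      by (rule continuous_on_eq) (simp add: local)
    then have "(g \<longlongrightarrow> g x) (at x within U)"
      using UV(3) by (simp add: continuous_on_def)
    moreover obtain O' where "open O'" "U = S \<inter> O'" using UV(1) by (auto simp: openin_open)
    then have "at x within U = at x within S"
      using UV(3) by (intro at_within_nhd[of x O']) auto
    ultimately show "(g \<longlongrightarrow> g x) (at x within S)" by simp
  qed
  then show ?thesis using that exp_L[OF g] by blast
qed

text \<open>Dividing by the square root of the determinant retracts an open set of matrices onto \<open>SL\<^sub>2(\<real>)\<close>.\<close>

lemma locally_path_connected_SL2R: "locally path_connected (carrier SL2R)"
proof (rule retract_of_locally_path_connected)
  show "locally path_connected {A::real^2^2. det A > 0}"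
    unfolding det_2 by (intro open_imp_locally_path_connected open_Collect_less continuous_intros)
  define r :: "real^2^2 \<Rightarrow> real^2^2" where "r = (\<lambda>A. (1 / sqrt (det A)) *\<^sub>R A)"
  show "carrier SL2R retract_of {A::real^2^2. det A > 0}"
    unfolding retract_of_def retraction_def
  proof (intro exI[of _ r] conjI)
    show "continuous_on {A. 0 < det A} r"
      unfolding r_def det_2 by (intro continuous_intros) auto
    show "r \<in> {A. 0 < det A} \<rightarrow> carrier SL2R"
    proof
      fix A :: "real^2^2" assume "A \<in> {A. 0 < det A}"
      then have p: "0 < det A" by simp
      have "det (c *\<^sub>R A) = c\<^sup>2 * det A" for c
        by (simp add: det_2 power2_eq_square algebra_simps)
      then show "r A \<in> carrier SL2R" using p by (simp add: SL2R_def r_def power_divide)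
    qed
  qed (auto simp: SL2R_def r_def)
qed

section \<open>The rotation part of a matrix as a complex number\<close>

text \<open>The space of 2 by 2 matrices is the sum of the multiples of rotations and the symmetric
  matrices of trace zero.  This is the first component, as a complex number, up to a factor 2; its
  direction is the rotation part of the polar decomposition.\<close>

definition polar_complex :: "real^2^2 \<Rightarrow> complex" where
  "polar_complex A = Complex (A$1$1 + A$2$2) (A$1$2 - A$2$1)"

lemma rot_nth: "rot \<theta> $1$1 = cos \<theta>" "rot \<theta> $1$2 = sin \<theta>" "rot \<theta> $2$1 = - sin \<theta>" "rot \<theta> $2$2 = cos \<theta>"
  by (simp_all add: rot_def vector_2)

lemma matrix_mult_2_nth: "((A::real^2^2) ** B) $ i $ j = A$i$1 * B$1$j + A$i$2 * B$2$j"
  by (simp add: matrix_matrix_mult_def sum_2)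

lemma matrix_2_eq_iff:
  "(A::real^2^2) = B \<longleftrightarrow> A$1$1 = B$1$1 \<and> A$1$2 = B$1$2 \<and> A$2$1 = B$2$1 \<and> A$2$2 = B$2$2"
  by (auto simp: vec_eq_iff forall_2)

lemma mat_1_2_nth: "(mat 1 :: real^2^2)$1$1 = 1" "(mat 1 :: real^2^2)$1$2 = 0"
   "(mat 1 :: real^2^2)$2$1 = 0" "(mat 1 :: real^2^2)$2$2 = 1"
  by (simp_all add: mat_def)

lemma rot_eq_iff: "rot \<theta> = rot \<phi> \<longleftrightarrow> cis \<theta> = cis \<phi>"
  by (auto simp: matrix_2_eq_iff rot_nth complex_eq_iff)

lemma rotation_matrix_rot: "rotation_matrix (rot \<theta>)"
  by (auto simp: rotation_matrix_def orthogonal_matrix_def matrix_2_eq_iff matrix_mult_2_nth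
      mat_1_2_nth rot_nth transpose_def det_2 power2_eq_square[symmetric])

lemma rotation_matrix_2D:
  assumes "rotation_matrix (R::real^2^2)"
  shows "\<exists>\<theta>. R = rot \<theta>"
proof -
  have 1: "R$1$1 * R$1$1 + R$1$2 * R$1$2 = 1" "R$1$1 * R$2$1 + R$1$2 * R$2$2 = 0"
     "R$2$1 * R$2$1 + R$2$2 * R$2$2 = 1" "R$1$1 * R$2$2 - R$1$2 * R$2$1 = 1"
    using assms by (auto simp: rotation_matrix_def orthogonal_matrix_def matrix_2_eq_iff matrix_mult_2_nth
      mat_1_2_nth transpose_def det_2)
  have "(R$1$1 - R$2$2)\<^sup>2 + (R$1$2 + R$2$1)\<^sup>2 = 0"
    using 1 by (simp add: power2_eq_square algebra_simps)
  then have 2: "R$2$2 = R$1$1" "R$2$1 = - R$1$2"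
    by (auto simp: sum_power2_eq_zero_iff)
  obtain \<theta> where "R$1$1 = cos \<theta>" "R$1$2 = sin \<theta>"
    using sincos_total_2pi[of "R$1$1" "R$1$2"] 1(1) by (metis power2_eq_square)
  then show ?thesis
    using 2 by (auto simp: matrix_2_eq_iff rot_nth)
qed

text \<open>Left multiplication by rotations preserves both summands, so the first component is
  equivariant.  For symmetric positive definite \<open>S\<close> it is the trace, a positive real number, which
  is what identifies the rotation part below.\<close>

lemma polar_complex_rot_mult: "polar_complex (rot \<theta> ** S) = cis \<theta> * polar_complex S"
  by (simp add: polar_complex_def matrix_mult_2_nth rot_nth complex_eq_iff algebra_simps)

lemma inner_mult_vec_2:
  "x \<bullet> ((S::real^2^2) *v x) = S$1$1 * (x$1)\<^sup>2 + (S$1$2 + S$2$1) * (x$1 * x$2) + S$2$2 * (x$2)\<^sup>2"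
  by (simp add: inner_vec_def matrix_vector_mult_def sum_2 power2_eq_square algebra_simps)

lemma sym_pos_def_2I:
  assumes "S$1$2 = S$2$1" "S$1$1 + S$2$2 > 0" "det S = 1"
  shows "sym_pos_def S"
  unfolding sym_pos_def_def
proof (intro conjI allI impI)
  show "transpose S = S" using assms by (simp add: matrix_2_eq_iff transpose_def)
  have d: "S$1$1 * S$2$2 = 1 + (S$1$2)\<^sup>2" using assms by (simp add: det_2 power2_eq_square)
  have s: "S$1$1 > 0"
  proof (rule ccontr)
    assume "\<not> S$1$1 > 0"
    with assms(2) have "S$1$1 * S$2$2 \<le> 0" by (intro mult_nonpos_nonneg) auto
    with d show False by (smt (verit) zero_le_power2)
  qed
  fix x :: "real^2" assume x: "x \<noteq> 0"
  \<comment> \<open>Completing the square, with determinant 1.\<close>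
  have "S$1$1 * (x \<bullet> (S *v x)) = (S$1$1 * x$1 + S$1$2 * x$2)\<^sup>2 + (S$1$1 * S$2$2 - (S$1$2)\<^sup>2) * (x$2)\<^sup>2"
    using assms(1) by (simp add: inner_mult_vec_2 power2_eq_square algebra_simps)
  also have "\<dots> = (S$1$1 * x$1 + S$1$2 * x$2)\<^sup>2 + (x$2)\<^sup>2" by (simp add: d)
  also have "\<dots> > 0"
  proof -
    have "x$2 \<noteq> 0 \<or> x$1 \<noteq> 0" using x by (auto simp: vec_eq_iff forall_2)
    then show ?thesis using s by (cases "x$2 = 0") (auto simp: add_nonneg_pos)
  qed
  finally show "x \<bullet> (S *v x) > 0" using s by (simp add: zero_less_mult_iff)
qed

lemma sym_pos_def_2_trace:
  assumes "sym_pos_def (S::real^2^2)"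
  shows "S$1$2 = S$2$1" "S$1$1 + S$2$2 > 0"
proof -
  have t: "transpose S = S" and p: "x \<noteq> 0 \<Longrightarrow> x \<bullet> (S *v x) > 0" for x
    using assms by (auto simp: sym_pos_def_def)
  show "S$1$2 = S$2$1" using arg_cong[OF t, of "\<lambda>M. M$1$2"] by (simp add: transpose_def)
  have "S$1$1 > 0" "S$2$2 > 0"
    using p[of "axis 1 1"] p[of "axis 2 1"] axis_eq_0_iff[of "1::2" "1::real"] axis_eq_0_iff[of "2::2" "1::real"]
    by (auto simp: inner_mult_vec_2 axis_def)
  then show "S$1$1 + S$2$2 > 0" by simp
qed

lemma polar_complex_nonzero:
  assumes "det A = 1" shows "polar_complex A \<noteq> 0"
proof
  assume "polar_complex A = 0"
  then have "A$2$2 = - A$1$1" "A$1$2 = A$2$1" by (auto simp: polar_complex_def complex_eq_iff)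
  with assms have "- (A$1$1)\<^sup>2 - (A$2$1)\<^sup>2 = 1" by (simp add: det_2 power2_eq_square)
  then show False by (smt (verit) zero_le_power2)
qed

lemma rot_eq_rotation_part_iff:
  assumes A: "det A = 1"
  shows "rot \<theta> = rotation_part A \<longleftrightarrow> cis \<theta> = sgn (polar_complex A)"
proof -
  define \<phi> where "\<phi> = Arg (polar_complex A)"
  have \<phi>: "cis \<phi> = sgn (polar_complex A)"
    using polar_complex_nonzero[OF A] by (simp add: \<phi>_def cis_Arg)
  have "rotation_part A = rot \<phi>"
    unfolding rotation_part_def
  proof (rule the_equality)
    define S where "S = rot (-\<phi>) ** A"
    have AS: "A = rot \<phi> ** S"
    proof -
      have "rot \<phi> ** rot (-\<phi>) = mat 1"
        by (simp add: matrix_2_eq_iff matrix_mult_2_nth rot_nth mat_1_2_nth power2_eq_square[symmetric])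
      then show ?thesis by (simp add: S_def matrix_mul_assoc)
    qed
    have "polar_complex S = cis (-\<phi>) * (of_real (norm (polar_complex A)) * sgn (polar_complex A))"
      by (simp add: S_def polar_complex_rot_mult sgn_div_norm scaleR_conv_of_real)
         (use polar_complex_nonzero[OF A] in simp)
    also have "\<dots> = of_real (norm (polar_complex A))"
      by (simp add: \<phi>[symmetric] cis_mult)
    finally have "polar_complex S = of_real (norm (polar_complex A))" .
    then have "S$1$2 = S$2$1" "S$1$1 + S$2$2 > 0"
      using polar_complex_nonzero[OF A] by (auto simp: polar_complex_def complex_eq_iff)
    moreover have "det S = 1"
      using A rotation_matrix_rot by (simp add: S_def det_mul rotation_matrix_def)
    ultimately have "sym_pos_def S" by (rule sym_pos_def_2I)
    then show "rotation_matrix (rot \<phi>) \<and> (\<exists>S. sym_pos_def S \<and> A = rot \<phi> ** S)"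
      using AS rotation_matrix_rot by blast
  next
    fix R assume "rotation_matrix R \<and> (\<exists>S. sym_pos_def S \<and> A = R ** S)"
    then obtain S \<theta> where S: "sym_pos_def S" "A = rot \<theta> ** S" "R = rot \<theta>"
      using rotation_matrix_2D by blast
    have "polar_complex S = of_real (S$1$1 + S$2$2)"
      using sym_pos_def_2_trace[OF S(1)] by (simp add: polar_complex_def complex_eq_iff)
    then have "polar_complex A = cis \<theta> * of_real (S$1$1 + S$2$2)"
      by (simp add: S(2) polar_complex_rot_mult)
    then have "sgn (polar_complex A) = cis \<theta>"
      using sym_pos_def_2_trace(2)[OF S(1)]
      by (simp only: sgn_mult sgn_cis sgn_of_real) simp
    then show "R = rot \<phi>" using \<phi> S(3) by (simp add: rot_eq_iff)
  qed
  then show ?thesis using \<phi> by (simp add: rot_eq_iff)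
qed

section \<open>Angles attached to geodesic edges\<close>

text \<open>Equal to \<open>\<i> * (cnj w - z)\<close>, with argument \<open>edge_angle z w\<close>.  Multiplying such numbers adds edge
  angles, and fractional linear transformations change them by factors of automorphy.\<close>

definition edge_number :: "complex \<Rightarrow> complex \<Rightarrow> complex" where
  "edge_number z w = Complex (Im z + Im w) (Re w - Re z)"

definition edge_angle :: "complex \<Rightarrow> complex \<Rightarrow> real" where
  "edge_angle z w = arctan ((Re w - Re z) / (Im z + Im w))"

lemma edge_angle_swap: "edge_angle w z = - edge_angle z w"
  unfolding edge_angle_def arctan_minus[symmetric] by (simp add: add.commute minus_divide_left)

lemma edge_angle_bound: "\<bar>edge_angle z w\<bar> < pi / 2"
  using arctan_bounded[of "(Re w - Re z) / (Im z + Im w)"] unfolding edge_angle_def by linarith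

lemma cis_edge_angle:
  assumes "Im z > 0" "Im w > 0"
  shows "cis (edge_angle z w) = sgn (edge_number z w)"
proof -
  define y x where "y = Im z + Im w" and "x = Re w - Re z"
  have y: "y > 0" using assms by (simp add: y_def)
  have n: "sqrt (x\<^sup>2 + y\<^sup>2) = y * sqrt (1 + (x / y)\<^sup>2)"
  proof -
    have "x\<^sup>2 + y\<^sup>2 = y\<^sup>2 * (1 + (x/y)\<^sup>2)" using y by (simp add: field_simps)
    then show ?thesis using y by (simp add: real_sqrt_mult)
  qed
  have "sgn (edge_number z w) = Complex (y / sqrt (x\<^sup>2 + y\<^sup>2)) (x / sqrt (x\<^sup>2 + y\<^sup>2))"
    by (simp add: edge_number_def sgn_div_norm complex_norm y_def x_def complex_eq_iff add.commute divide_inverse)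
  moreover have "cis (edge_angle z w) = Complex (1 / sqrt (1 + (x/y)\<^sup>2)) ((x/y) / sqrt (1 + (x/y)\<^sup>2))"
    by (simp add: edge_angle_def cos_arctan sin_arctan complex_eq_iff x_def y_def)
  ultimately show ?thesis using y by (simp add: n complex_eq_iff)
qed

text \<open>Twice the signed Euclidean area of the triangle with vertices \<open>(Re z, (cmod z)\<^sup>2)\<close> for
  \<open>z = A, B, C\<close>.\<close>

definition klein_det :: "complex \<Rightarrow> complex \<Rightarrow> complex \<Rightarrow> real" where
  "klein_det A B C = (Re B - Re A) * ((cmod C)\<^sup>2 - (cmod A)\<^sup>2) - (Re C - Re A) * ((cmod B)\<^sup>2 - (cmod A)\<^sup>2)"

lemma Im_edge_product:
  "Im (edge_number A B * edge_number B C * edge_number C A) = klein_det A B C"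
  unfolding edge_number_def klein_det_def cmod_power2 by (simp add: power2_eq_square algebra_simps)

text \<open>The three differences of real parts add up to zero, which turns the real part into a sum of
  nonnegative terms.\<close>

lemma Re_edge_product_pos:
  assumes "Im A > 0" "Im B > 0" "Im C > 0"
  shows "Re (edge_number A B * edge_number B C * edge_number C A) > 0"
proof -
  have "Re (edge_number A B * edge_number B C * edge_number C A) =
     (Im A + Im B) * (Im B + Im C) * (Im C + Im A) +
     Im B * (Re C - Re A)\<^sup>2 + Im A * (Re C - Re B)\<^sup>2 + Im C * (Re B - Re A)\<^sup>2"
    by (simp add: edge_number_def power2_eq_square algebra_simps)
  also have "\<dots> > 0" using assms by (intro add_pos_nonneg mult_pos_pos mult_nonneg_nonneg) auto
  finally show ?thesis .
qed

definition edge_sum :: "complex \<Rightarrow> complex \<Rightarrow> complex \<Rightarrow> real" where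
  "edge_sum A B C = edge_angle A B + edge_angle B C + edge_angle C A"

lemma cis_edge_sum:
  assumes "Im A > 0" "Im B > 0" "Im C > 0"
  shows "cis (edge_sum A B C) = sgn (edge_number A B * edge_number B C * edge_number C A)"
  using assms by (simp add: edge_sum_def cis_mult[symmetric] cis_edge_angle sgn_mult)

lemma abs_less_pi_half_if_cos_pos:
  assumes "\<bar>x\<bar> < 3 * pi / 2" "cos x > 0"
  shows "\<bar>x\<bar> < pi / 2"
proof (rule ccontr)
  assume "\<not> \<bar>x\<bar> < pi / 2"
  then have "cos (\<bar>x\<bar> - pi) \<ge> 0" using assms(1) by (intro cos_ge_zero) auto
  then show False using assms(2) by simp
qed

text \<open>The three arctangents only give the bound \<open>3 * pi / 2\<close>; on that range, positivity of the cosine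
  is equivalent to the bound \<open>pi / 2\<close>.\<close>

lemma edge_sum_bound:
  assumes "Im A > 0" "Im B > 0" "Im C > 0"
  shows "\<bar>edge_sum A B C\<bar> < pi / 2"
proof (rule abs_less_pi_half_if_cos_pos)
  show "\<bar>edge_sum A B C\<bar> < 3 * pi / 2"
    using edge_angle_bound[of A B] edge_angle_bound[of B C] edge_angle_bound[of C A]
    unfolding edge_sum_def by linarith
  let ?P = "edge_number A B * edge_number B C * edge_number C A"
  have "cos (edge_sum A B C) = Re ?P / cmod ?P"
    using arg_cong[OF cis_edge_sum[OF assms], of Re] by simp
  moreover have "?P \<noteq> 0" using Re_edge_product_pos[OF assms] by force
  ultimately show "cos (edge_sum A B C) > 0" using Re_edge_product_pos[OF assms] by (metis divide_pos_pos zero_less_norm_iff)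
qed

lemma edge_sum_eq_0:
  assumes "Im A > 0" "Im B > 0" "Im C > 0" "klein_det A B C = 0"
  shows "edge_sum A B C = 0"
proof -
  have "sin (edge_sum A B C) = 0"
    using arg_cong[OF cis_edge_sum[OF assms(1-3)], of Im] Im_edge_product[of A B C] assms(4)
    by (simp del: times_complex.sel)
  then show ?thesis using edge_sum_bound[OF assms(1-3)] sin_eq_0_pi[of "edge_sum A B C"] by auto
qed

section \<open>The rotation part of a product\<close>

text \<open>The factor of automorphy \<open>c z + d\<close>, the denominator of the fractional linear transformation.\<close>

definition automorphy :: "real^2^2 \<Rightarrow> complex \<Rightarrow> complex" where
  "automorphy A z = of_real (A$2$1) * z + of_real (A$2$2)"

lemma automorphy_nonzero:
  assumes "det A = 1" "Im z > 0" shows "automorphy A z \<noteq> 0"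
proof
  assume "automorphy A z = 0"
  then have "A$2$1 = 0" "A$2$2 = 0"
    using assms(2) by (auto simp: automorphy_def complex_eq_iff)
  then show False using assms(1) by (simp add: det_2)
qed

lemma mobius_automorphy:
  assumes "det A = 1" "Im z > 0"
  shows "mobius A z * automorphy A z = of_real (A$1$1) * z + of_real (A$1$2)"
  using automorphy_nonzero[OF assms] by (simp add: mobius_def moebius_def automorphy_def)

lemma mobius_minus_cnj:
  assumes "det A = 1" "Im z > 0" "Im w > 0"
  shows "(mobius A z - cnj (mobius A w)) * (automorphy A z * cnj (automorphy A w)) = z - cnj w"
proof -
  let ?a = "\<lambda>i j. complex_of_real (A$i$j)"
  have d: "?a 1 1 * ?a 2 2 - ?a 1 2 * ?a 2 1 = 1"
    using assms(1) unfolding det_2 by (metis of_real_1 of_real_diff of_real_mult)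
  have "(mobius A z - cnj (mobius A w)) * (automorphy A z * cnj (automorphy A w)) =
     (mobius A z * automorphy A z) * cnj (automorphy A w) - cnj (mobius A w * automorphy A w) * automorphy A z"
    by (simp add: algebra_simps)
  also have "\<dots> = (?a 1 1 * ?a 2 2 - ?a 1 2 * ?a 2 1) * (z - cnj w)"
    unfolding mobius_automorphy[OF assms(1,2)] mobius_automorphy[OF assms(1,3)]
    by (simp add: automorphy_def algebra_simps)
  finally show ?thesis by (simp add: d)
qed

lemma Im_mobius_pos:
  assumes "det A = 1" "Im z > 0" shows "Im (mobius A z) > 0"
proof -
  let ?n = "(cmod (automorphy A z))\<^sup>2"
  have "(mobius A z - cnj (mobius A z)) * of_real ?n = z - cnj z"
    using mobius_minus_cnj[OF assms(1,2,2)] by (simp only: complex_norm_square)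
  then have "Im (mobius A z) * ?n = Im z"
    by (simp add: complex_diff_cnj complex_eq_iff)
  then show ?thesis
    using assms(2) automorphy_nonzero[OF assms] by (metis zero_less_mult_pos2 zero_less_norm_iff zero_less_power)
qed

lemma
  assumes "det A = 1" "det B = 1" "Im z > 0"
  shows automorphy_mult: "automorphy (B ** A) z = automorphy B (mobius A z) * automorphy A z"
    and mobius_mult: "mobius (B ** A) z = mobius B (mobius A z)"
proof -
  let ?a = "\<lambda>i j. complex_of_real (A$i$j)" and ?b = "\<lambda>i j. complex_of_real (B$i$j)"
  have m: "mobius A z * automorphy A z = ?a 1 1 * z + ?a 1 2"
    using mobius_automorphy assms by blast
  have "automorphy B (mobius A z) * automorphy A z = ?b 2 1 * (mobius A z * automorphy A z) + ?b 2 2 * automorphy A z"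
    by (simp add: automorphy_def[of B] algebra_simps)
  also have "\<dots> = automorphy (B ** A) z"
    unfolding m by (simp add: automorphy_def matrix_mult_2_nth algebra_simps)
  finally show 1: "automorphy (B ** A) z = automorphy B (mobius A z) * automorphy A z" by simp
  have BA: "det (B ** A) = 1" using assms by (simp add: det_mul)
  have "mobius (B ** A) z * automorphy (B ** A) z = ?b 1 1 * (?a 1 1 * z + ?a 1 2) + ?b 1 2 * automorphy A z"
    unfolding mobius_automorphy[OF BA assms(3)]
    by (simp add: automorphy_def matrix_mult_2_nth algebra_simps)
  also have "\<dots> = (?b 1 1 * mobius A z + ?b 1 2) * automorphy A z"
    unfolding m[symmetric] by (simp add: algebra_simps)
  also have "\<dots> = mobius B (mobius A z) * automorphy (B ** A) z"
    unfolding 1 mobius_automorphy[OF assms(2) Im_mobius_pos[OF assms(1,3)], symmetric] by simp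
  finally show "mobius (B ** A) z = mobius B (mobius A z)"
    using automorphy_nonzero[OF BA assms(3)] by simp
qed

lemma cnj_polar_complex:
  assumes "det A = 1"
  shows "cnj (polar_complex A) = - \<i> * automorphy A \<i> * (mobius A \<i> + \<i>)"
proof -
  have "- \<i> * automorphy A \<i> * (mobius A \<i> + \<i>) = - \<i> * (mobius A \<i> * automorphy A \<i>) + automorphy A \<i>"
    by (simp add: algebra_simps)
  also have "\<dots> = cnj (polar_complex A)"
    unfolding mobius_automorphy[OF assms, of \<i>, simplified] by (simp add: automorphy_def polar_complex_def complex_eq_iff)
  finally show ?thesis ..
qed

lemma cnj_edge_number: "cnj (edge_number z w) = - \<i> * (w - cnj z)"
  by (simp add: edge_number_def complex_eq_iff)

text \<open>The factors of automorphy of \<open>B A\<close> split by the cocycle rule.  The remaining factor of \<open>B\<close> at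
  \<open>A \<i>\<close>, rather than at \<open>\<i>\<close>, is expressed by \<open>mobius_minus_cnj\<close> through the difference
  \<open>w - cnj u\<close>, which is an edge number.  Everything left over is a positive real number.\<close>

lemma sgn_polar_complex_mult:
  assumes A: "det A = 1" and B: "det B = 1"
  defines "u \<equiv> mobius B \<i>" and "w \<equiv> mobius B (mobius A \<i>)"
  shows "sgn (polar_complex (B ** A)) * sgn (edge_number \<i> u * edge_number u w * edge_number w \<i>)
    = sgn (polar_complex B) * sgn (polar_complex A)"
proof -
  let ?z = "mobius A \<i>"
  have z: "Im ?z > 0" using Im_mobius_pos[OF A] by simp
  have w: "Im w > 0" using Im_mobius_pos[OF B z] by (simp add: w_def)
  have BA: "det (B ** A) = 1" using assms by (simp add: det_mul)
  let ?jA = "automorphy A \<i>" and ?jB = "automorphy B \<i>" and ?jz = "automorphy B ?z"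
  have jB: "?jB \<noteq> 0" using automorphy_nonzero[OF B] by simp
  have wi: "w + \<i> \<noteq> 0" using w by (auto simp: complex_eq_iff)
  have c: "(w - cnj u) * (?jz * cnj ?jB) = ?z + \<i>"
    using mobius_minus_cnj[OF B z, of \<i>] by (simp add: u_def w_def)
  have w': "mobius (B ** A) \<i> = w" "automorphy (B ** A) \<i> = ?jz * ?jA"
    using mobius_mult[OF A B, of \<i>] automorphy_mult[OF A B, of \<i>] by (simp_all add: w_def)
  let ?P = "edge_number \<i> u * edge_number u w * edge_number w \<i>"
  have "cnj (polar_complex (B ** A) * ?P) * of_real ((cmod ?jB)\<^sup>2)
      = (- \<i> * (?jz * ?jA) * (w + \<i>)) * ((- \<i> * (u + \<i>)) * (- \<i> * (w - cnj u)) * (- \<i> * (\<i> - cnj w))) * (?jB * cnj ?jB)"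
    by (simp only: complex_cnj_mult cnj_polar_complex[OF BA] cnj_edge_number w' complex_norm_square)
       simp
  also have "\<dots> = - ((w + \<i>) * cnj (w + \<i>)) * (?jA * ?jB * (u + \<i>)) * ((w - cnj u) * (?jz * cnj ?jB))"
    by (simp add: algebra_simps)
  also have "\<dots> = of_real ((cmod (w + \<i>))\<^sup>2) * ((- \<i> * ?jB * (u + \<i>)) * (- \<i> * ?jA * (?z + \<i>)))"
    unfolding c complex_norm_square by (simp add: algebra_simps)
  also have "\<dots> = of_real ((cmod (w + \<i>))\<^sup>2) * cnj (polar_complex B * polar_complex A)"
    by (simp only: complex_cnj_mult cnj_polar_complex[OF A] cnj_polar_complex[OF B] u_def)
  finally have "cnj (polar_complex (B ** A) * ?P * of_real ((cmod ?jB)\<^sup>2)) =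
      cnj (polar_complex B * polar_complex A * of_real ((cmod (w + \<i>))\<^sup>2))"
    by (simp add: mult_ac)
  then have "polar_complex (B ** A) * ?P * of_real ((cmod ?jB)\<^sup>2) =
      polar_complex B * polar_complex A * of_real ((cmod (w + \<i>))\<^sup>2)"
    by (simp only: complex_cnj_cancel_iff)
  then have "sgn (polar_complex (B ** A) * ?P * of_real ((cmod ?jB)\<^sup>2)) =
      sgn (polar_complex B * polar_complex A * of_real ((cmod (w + \<i>))\<^sup>2))"
    by simp
  moreover have "sgn (complex_of_real ((cmod ?jB)\<^sup>2)) = 1" "sgn (complex_of_real ((cmod (w + \<i>))\<^sup>2)) = 1"
    using jB wi by (simp_all only: sgn_of_real) (simp_all add: sgn_if)
  ultimately show ?thesis by (simp only: sgn_mult mult_1_right)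
qed

section \<open>Geodesics in projective coordinates\<close>

text \<open>The projective model with the parabola \<open>s = x\<^sup>2\<close> as absolute conic, in which the half plane is
  the region \<open>s > x\<^sup>2\<close>.\<close>

definition klein :: "complex \<Rightarrow> real \<times> real" where
  "klein z = (Re z, (cmod z)\<^sup>2)"
text \<open>The bilinear form of the conic, in the homogeneous coordinates \<open>(1, x, s)\<close>.  Up to normalization it is the Minkowski product of the
  hyperboloid model, so that \<open>klein_form A B / (2 * Im A * Im B)\<close> is the hyperbolic cosine of the
  distance.\<close>

definition klein_form :: "complex \<Rightarrow> complex \<Rightarrow> real" where
  "klein_form A B = (cmod A)\<^sup>2 + (cmod B)\<^sup>2 - 2 * Re A * Re B"

lemma klein_form_alt: "klein_form A B = (Re A - Re B)\<^sup>2 + (Im A)\<^sup>2 + (Im B)\<^sup>2"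
  unfolding klein_form_def cmod_power2 by (simp add: power2_eq_square algebra_simps)

lemma klein_form_ge: "klein_form A B \<ge> 2 * Im A * Im B"
  using sum_squares_bound[of "Im A" "Im B"] unfolding klein_form_alt by (smt (verit) zero_le_power2)

lemma klein_form_eq_imp_eq:
  assumes "klein_form A B \<le> 2 * Im A * Im B"
  shows "A = B"
proof -
  have "(Re A - Re B)\<^sup>2 + (Im A - Im B)\<^sup>2 \<le> 0"
    using assms unfolding klein_form_alt by (simp add: power2_diff)
  then show ?thesis by (auto simp: complex_eq_iff sum_power2_le_zero_iff)
qed

lemma hdist_klein_form:
  assumes "Im A > 0" "Im B > 0"
  shows "hdist A B = arcosh (klein_form A B / (2 * Im A * Im B))"
proof -
  have "1 + (cmod (A - B))\<^sup>2 / (2 * Im A * Im B) = klein_form A B / (2 * Im A * Im B)"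
    using assms unfolding klein_form_alt cmod_power2 by (simp add: field_simps power2_eq_square)
  then show ?thesis by (simp add: hdist_def)
qed

text \<open>Apply \<open>cosh\<close> and its addition theorem, then square; the first conjunct keeps the squaring
  reversible.\<close>

lemma arcosh_add_eq_iff:
  fixes a b c :: real
  assumes "a \<ge> 1" "b \<ge> 1" "c \<ge> 1"
  shows "arcosh a + arcosh b = arcosh c \<longleftrightarrow> a * b \<le> c \<and> (c - a * b)\<^sup>2 = (a\<^sup>2 - 1) * (b\<^sup>2 - 1)"
proof -
  define s where "s = sqrt (a\<^sup>2 - 1) * sqrt (b\<^sup>2 - 1)"
  have nn: "arcosh x \<ge> 0" if "x \<ge> 1" for x :: real
    using that arcosh_real_gt_1_iff[of x] by (cases "x = 1") auto
  have s: "s \<ge> 0" "s\<^sup>2 = (a\<^sup>2 - 1) * (b\<^sup>2 - 1)"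
    using assms by (simp_all add: s_def power_mult_distrib one_le_power)
  have "arcosh a + arcosh b = arcosh c \<longleftrightarrow> cosh (arcosh a + arcosh b) = cosh (arcosh c)"
    using nn assms by (metis add_nonneg_nonneg cosh_real_nonneg_le_iff order_antisym order_refl)
  also have "\<dots> \<longleftrightarrow> a * b + s = c"
    using assms by (simp add: cosh_add cosh_arcosh_real sinh_arcosh_real s_def)
  also have "\<dots> \<longleftrightarrow> a * b \<le> c \<and> (c - a * b)\<^sup>2 = s\<^sup>2"
    using s(1) by (smt (verit) power2_eq_iff_nonneg)
  finally show ?thesis by (simp add: s(2))
qed

text \<open>In terms of the hyperbolic cosines, the left side is, up to a positive factor, minus the Gram determinant of three vectors,
  and a Gram determinant is a constant times the square of a determinant.\<close>

lemma gram_identity: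
  fixes x1 x2 x3 p q r :: real
  defines "s1 \<equiv> x1\<^sup>2 + p\<^sup>2" and "s2 \<equiv> x2\<^sup>2 + q\<^sup>2" and "s3 \<equiv> x3\<^sup>2 + r\<^sup>2"
  defines "m12 \<equiv> s1 + s2 - 2 * x1 * x2" and "m13 \<equiv> s1 + s3 - 2 * x1 * x3" and "m32 \<equiv> s3 + s2 - 2 * x3 * x2"
  shows "(2 * r\<^sup>2 * m12 - m13 * m32)\<^sup>2 - (m13\<^sup>2 - 4 * p\<^sup>2 * r\<^sup>2) * (m32\<^sup>2 - 4 * r\<^sup>2 * q\<^sup>2)
    = - 4 * r\<^sup>2 * ((x2 - x1) * (s3 - s1) - (x3 - x1) * (s2 - s1))\<^sup>2"
proof -
  have p: "p\<^sup>2 = s1 - x1\<^sup>2" and q: "q\<^sup>2 = s2 - x2\<^sup>2" and r: "r\<^sup>2 = s3 - x3\<^sup>2" by (simp_all add: s1_def s2_def s3_def)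
  show ?thesis unfolding p q r m12_def m13_def m32_def by algebra
qed

lemma hdist_add_eq_iff:
  assumes "Im A > 0" "Im B > 0" "Im X > 0"
  shows "hdist A X + hdist X B = hdist A B \<longleftrightarrow>
    klein_form A X * klein_form X B \<le> klein_form X X * klein_form A B \<and> klein_det A B X = 0"
proof -
  let ?p = "Im A" and ?q = "Im B" and ?r = "Im X"
  let ?m = "klein_form A B" and ?m1 = "klein_form A X" and ?m2 = "klein_form X B"
  let ?a = "?m1 / (2 * ?p * ?r)" and ?b = "?m2 / (2 * ?r * ?q)" and ?c = "?m / (2 * ?p * ?q)"
  have pos: "?p * ?q > 0" "?p * ?r > 0" "?r * ?q > 0" "?p * ?q * ?r\<^sup>2 > 0" using assms by auto
  have ge: "?a \<ge> 1" "?b \<ge> 1" "?c \<ge> 1"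
    using pos klein_form_ge[of A X] klein_form_ge[of X B] klein_form_ge[of A B]
    by (simp_all add: le_divide_eq mult.assoc)
  have r: "klein_form X X = 2 * ?r\<^sup>2" by (simp add: klein_form_alt)
  have c_ab: "?c - ?a * ?b = (2 * ?r\<^sup>2 * ?m - ?m1 * ?m2) / (4 * (?p * ?q * ?r\<^sup>2))"
    using assms by (simp add: field_simps power2_eq_square)
  have "?a * ?b \<le> ?c \<longleftrightarrow> 0 \<le> ?c - ?a * ?b" by linarith
  also have "\<dots> \<longleftrightarrow> ?m1 * ?m2 \<le> klein_form X X * ?m"
    unfolding c_ab r using pos(4) by (simp add: zero_le_divide_iff)
  finally have 1: "?a * ?b \<le> ?c \<longleftrightarrow> ?m1 * ?m2 \<le> klein_form X X * ?m" .
  have "(?c - ?a * ?b)\<^sup>2 - (?a\<^sup>2 - 1) * (?b\<^sup>2 - 1) =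
      ((2 * ?r\<^sup>2 * ?m - ?m1 * ?m2)\<^sup>2 - (?m1\<^sup>2 - 4 * ?p\<^sup>2 * ?r\<^sup>2) * (?m2\<^sup>2 - 4 * ?r\<^sup>2 * ?q\<^sup>2)) / (4 * (?p * ?q * ?r\<^sup>2))\<^sup>2"
    unfolding c_ab using assms by (simp add: field_simps power2_eq_square)
  also have "\<dots> = - 4 * ?r\<^sup>2 * (klein_det A B X)\<^sup>2 / (4 * (?p * ?q * ?r\<^sup>2))\<^sup>2"
    using gram_identity[of ?r "Re A" ?p "Re B" ?q "Re X"]
    unfolding klein_form_def klein_det_def cmod_power2 by simp
  finally have "(?c - ?a * ?b)\<^sup>2 = (?a\<^sup>2 - 1) * (?b\<^sup>2 - 1) \<longleftrightarrow> - 4 * ?r\<^sup>2 * (klein_det A B X)\<^sup>2 / (4 * (?p * ?q * ?r\<^sup>2))\<^sup>2 = 0"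
    by linarith
  also have "\<dots> \<longleftrightarrow> klein_det A B X = 0" using assms by simp
  finally have 2: "(?c - ?a * ?b)\<^sup>2 = (?a\<^sup>2 - 1) * (?b\<^sup>2 - 1) \<longleftrightarrow> klein_det A B X = 0" .
  show ?thesis
    unfolding hdist_klein_form[OF assms(1,3)] hdist_klein_form[OF assms(3,2)] hdist_klein_form[OF assms(1,2)]
      arcosh_add_eq_iff[OF ge] 1 2 ..
qed

lemma klein_form_on_line:
  assumes "Re X = (1 - t) * Re A + t * Re B" "(cmod X)\<^sup>2 = (1 - t) * (cmod A)\<^sup>2 + t * (cmod B)\<^sup>2"
  shows "klein_form X X * klein_form A B - klein_form A X * klein_form X B
    = t * (1 - t) * ((klein_form A B)\<^sup>2 - (2 * Im A * Im B)\<^sup>2)"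
proof -
  have "(2 * Im A * Im B)\<^sup>2 = klein_form A A * klein_form B B"
    by (simp add: klein_form_alt power_mult_distrib)
  then show ?thesis
    unfolding klein_form_def assms by algebra
qed

lemma klein_inj: "inj_on klein upper_half_plane"
proof (rule inj_onI)
  fix z w assume zw: "z \<in> upper_half_plane" "w \<in> upper_half_plane" "klein z = klein w"
  then have "Re z = Re w" "(Im z)\<^sup>2 = (Im w)\<^sup>2"
    by (auto simp: klein_def cmod_power2)
  then show "z = w" using zw by (auto simp: complex_eq_iff upper_half_plane_def power2_eq_iff)
qed

text \<open>Equality in the triangle inequality forces collinearity, by \<open>hdist_add_eq_iff\<close>.  On a line with
  parameter \<open>t\<close> the remaining inequality says \<open>0 \<le> t * (1 - t)\<close>, by \<open>klein_form_on_line\<close>.\<close>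

lemma hsegment_iff_klein:
  assumes "A \<in> upper_half_plane" "B \<in> upper_half_plane" "X \<in> upper_half_plane"
  shows "X \<in> hsegment A B \<longleftrightarrow> klein X \<in> closed_segment (klein A) (klein B)"
proof -
  have pos: "Im A > 0" "Im B > 0" "Im X > 0" using assms by (auto simp: upper_half_plane_def)
  have seg: "klein X \<in> closed_segment (klein A) (klein B) \<longleftrightarrow>
      (\<exists>t. 0 \<le> t \<and> t \<le> 1 \<and> Re X = (1 - t) * Re A + t * Re B \<and> (cmod X)\<^sup>2 = (1 - t) * (cmod A)\<^sup>2 + t * (cmod B)\<^sup>2)"
    by (auto simp: closed_segment_def klein_def)
  have hs: "X \<in> hsegment A B \<longleftrightarrow> klein_form A X * klein_form X B \<le> klein_form X X * klein_form A B \<and> klein_det A B X = 0"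
    using assms hdist_add_eq_iff[OF pos] by (simp add: hsegment_def)
  show ?thesis
  proof
    assume "klein X \<in> closed_segment (klein A) (klein B)"
    then obtain t where t: "0 \<le> t" "t \<le> 1" and X: "Re X = (1 - t) * Re A + t * Re B" "(cmod X)\<^sup>2 = (1 - t) * (cmod A)\<^sup>2 + t * (cmod B)\<^sup>2"
      using seg by blast
    have "(2 * Im A * Im B)\<^sup>2 \<le> (klein_form A B)\<^sup>2"
      using pos by (intro power_mono klein_form_ge) auto
    then have "0 \<le> t * (1 - t) * ((klein_form A B)\<^sup>2 - (2 * Im A * Im B)\<^sup>2)"
      using t by (intro mult_nonneg_nonneg) auto
    moreover have "klein_det A B X = 0" unfolding klein_det_def X by (simp add: algebra_simps)
    ultimately show "X \<in> hsegment A B" using hs klein_form_on_line[OF X] by linarith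
  next
    assume "X \<in> hsegment A B"
    then have le: "klein_form A X * klein_form X B \<le> klein_form X X * klein_form A B" and D: "klein_det A B X = 0"
      using hs by auto
    show "klein X \<in> closed_segment (klein A) (klein B)"
    proof (cases "A = B")
      case True
      have "klein_form A X * klein_form A X \<le> (2 * Im A * Im X) * (2 * Im A * Im X)"
        using le unfolding True by (simp add: klein_form_alt power2_eq_square algebra_simps power2_commute)
      then have "klein_form A X \<le> 2 * Im A * Im X"
        using pos by (metis abs_le_square_iff abs_of_pos klein_form_ge less_le_trans mult_pos_pos power2_eq_square zero_less_numeral)
      then have "A = X" by (rule klein_form_eq_imp_eq)
      then show ?thesis by simp
    next
      case False
      \<comment> \<open>The parameter of a point on the line is its orthogonal projection to the direction vector.\<close>
      define c where "c = (Re B - Re A)\<^sup>2 + ((cmod B)\<^sup>2 - (cmod A)\<^sup>2)\<^sup>2"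
      have "klein A \<noteq> klein B" using False assms klein_inj by (auto simp: inj_on_def)
      then have c: "c \<noteq> 0" by (auto simp: c_def klein_def sum_power2_eq_zero_iff)
      define t where "t = ((Re X - Re A) * (Re B - Re A) + ((cmod X)\<^sup>2 - (cmod A)\<^sup>2) * ((cmod B)\<^sup>2 - (cmod A)\<^sup>2)) / c"
      have tc: "t * c = (Re X - Re A) * (Re B - Re A) + ((cmod X)\<^sup>2 - (cmod A)\<^sup>2) * ((cmod B)\<^sup>2 - (cmod A)\<^sup>2)"
        using c by (simp add: t_def)
      have D': "(Re B - Re A) * ((cmod X)\<^sup>2 - (cmod A)\<^sup>2) = (Re X - Re A) * ((cmod B)\<^sup>2 - (cmod A)\<^sup>2)"
        using D by (simp add: klein_det_def)
      have "(Re X - Re A) * c = (t * c) * (Re B - Re A)"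
        unfolding tc unfolding c_def using D' by algebra
      then have "(Re X - Re A) * c = (t * (Re B - Re A)) * c" by (simp add: mult_ac)
      then have "Re X - Re A = t * (Re B - Re A)" by (rule mult_right_cancel[OF c, THEN iffD1])
      then have X1: "Re X = (1 - t) * Re A + t * Re B" by (simp add: algebra_simps)
      have "((cmod X)\<^sup>2 - (cmod A)\<^sup>2) * c = (t * c) * ((cmod B)\<^sup>2 - (cmod A)\<^sup>2)"
        unfolding tc unfolding c_def using D' by algebra
      then have "((cmod X)\<^sup>2 - (cmod A)\<^sup>2) * c = (t * ((cmod B)\<^sup>2 - (cmod A)\<^sup>2)) * c" by (simp add: mult_ac)
      then have "(cmod X)\<^sup>2 - (cmod A)\<^sup>2 = t * ((cmod B)\<^sup>2 - (cmod A)\<^sup>2)" by (rule mult_right_cancel[OF c, THEN iffD1])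
      then have X2: "(cmod X)\<^sup>2 = (1 - t) * (cmod A)\<^sup>2 + t * (cmod B)\<^sup>2" by (simp add: algebra_simps)
      have "klein_form A B > 2 * Im A * Im B"
        using False klein_form_eq_imp_eq[of A B] by force
      then have "(klein_form A B)\<^sup>2 - (2 * Im A * Im B)\<^sup>2 > 0"
        using pos power_strict_mono[of "2 * Im A * Im B" "klein_form A B" 2] by simp
      moreover have "0 \<le> t * (1 - t) * ((klein_form A B)\<^sup>2 - (2 * Im A * Im B)\<^sup>2)"
        using le klein_form_on_line[OF X1 X2] by linarith
      ultimately have "0 \<le> t * (1 - t)" by (simp add: zero_le_mult_iff)
      then have "0 \<le> t" "t \<le> 1" by (auto simp: zero_le_mult_iff)
      then show ?thesis using seg X1 X2 by blast
    qed
  qed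
qed

text \<open>The region above a parabola is convex.\<close>

lemma klein_segment_lift:
  assumes "A \<in> upper_half_plane" "B \<in> upper_half_plane" "q \<in> closed_segment (klein A) (klein B)"
  obtains Z where "Z \<in> upper_half_plane" "klein Z = q"
proof -
  obtain t where t: "0 \<le> t" "t \<le> 1" and q: "q = ((1 - t) * Re A + t * Re B, (1 - t) * (cmod A)\<^sup>2 + t * (cmod B)\<^sup>2)"
    using assms(3) by (auto simp: closed_segment_def klein_def)
  define d where "d = snd q - (fst q)\<^sup>2"
  have "d = (1 - t) * (Im A)\<^sup>2 + t * (Im B)\<^sup>2 + t * (1 - t) * (Re A - Re B)\<^sup>2"
    unfolding d_def q fst_conv snd_conv cmod_power2 by algebra
  also have "\<dots> > 0"
  proof -
    have "(1 - t) * (Im A)\<^sup>2 + t * (Im B)\<^sup>2 > 0"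
      using t assms(1,2) by (cases "t = 0") (auto simp: upper_half_plane_def intro!: add_nonneg_pos)
    then show ?thesis using t by (simp add: add_pos_nonneg)
  qed
  finally have d: "d > 0" .
  show ?thesis
  proof
    show "Complex (fst q) (sqrt d) \<in> upper_half_plane" using d by (simp add: upper_half_plane_def)
    show "klein (Complex (fst q) (sqrt d)) = q"
      using d by (simp add: klein_def cmod_power2 prod_eq_iff) (simp add: d_def)
  qed
qed

lemma hconvex_hull_klein:
  assumes S: "S \<subseteq> upper_half_plane"
  shows "hconvex hull S = {z \<in> upper_half_plane. klein z \<in> convex hull (klein ` S)}" (is "_ = ?R")
proof
  have "hconvex ?R"
    unfolding hconvex_def
  proof (intro conjI ballI subsetI)
    fix A B X assume AB: "A \<in> ?R" "B \<in> ?R" and X: "X \<in> hsegment A B"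
    have XH: "X \<in> upper_half_plane" using X by (simp add: hsegment_def)
    then have "klein X \<in> closed_segment (klein A) (klein B)"
      using AB X hsegment_iff_klein by auto
    then show "X \<in> ?R" using AB XH
      using closed_segment_subset[OF _ _ convex_convex_hull] by blast
  qed auto
  then show "hconvex hull S \<subseteq> ?R"
    using S by (intro hull_minimal) (auto intro: hull_inc)
next
  let ?T = "hconvex hull S"
  have H: "hconvex upper_half_plane" by (auto simp: hconvex_def hsegment_def)
  have TH: "?T \<subseteq> upper_half_plane" using S H by (rule hull_minimal)
  have T: "hconvex ?T"
  proof (rule hconvex_def[THEN iffD2], intro conjI ballI TH)
    fix A B assume AB: "A \<in> ?T" "B \<in> ?T"
    have "hsegment A B \<subseteq> K" if K: "hconvex K" "S \<subseteq> K" for K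
    proof -
      have "?T \<subseteq> K" using K(2,1) by (rule hull_minimal)
      then have "A \<in> K" "B \<in> K" using AB by auto
      then show ?thesis using K(1) by (simp add: hconvex_def)
    qed
    then show "hsegment A B \<subseteq> ?T"
      unfolding hull_def by (intro Inter_greatest) simp
  qed
  have "convex (klein ` ?T)"
    unfolding convex_contains_segment
  proof (intro ballI subsetI)
    fix a b q assume "a \<in> klein ` ?T" "b \<in> klein ` ?T" and q: "q \<in> closed_segment a b"
    then obtain A B where AB: "A \<in> ?T" "B \<in> ?T" "a = klein A" "b = klein B" by auto
    have "A \<in> upper_half_plane" "B \<in> upper_half_plane" using AB TH by auto
    moreover obtain Z where "Z \<in> upper_half_plane" "klein Z = q"
      using klein_segment_lift[OF calculation q[unfolded AB(3,4)]] .
    ultimately have "Z \<in> hsegment A B" using hsegment_iff_klein q AB by auto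
    then show "q \<in> klein ` ?T" using T AB \<open>klein Z = q\<close> unfolding hconvex_def by blast
  qed
  moreover have "klein ` S \<subseteq> klein ` ?T"
    by (intro image_mono hull_subset)
  ultimately have hull: "convex hull (klein ` S) \<subseteq> klein ` ?T"
    by (intro hull_minimal)
  show "?R \<subseteq> ?T"
  proof
    fix z assume z: "z \<in> ?R"
    then obtain w where w: "w \<in> ?T" "klein z = klein w" using hull by blast
    have "z = w" using inj_onD[OF klein_inj w(2)] z w(1) TH by blast
    then show "z \<in> ?T" using w(1) by simp
  qed
qed

lemma Im_cayley_cross_product: "Im (cnj ((B - A) * cnj (B - cnj A)) * ((C - A) * cnj (C - cnj A))) = 2 * Im A * klein_det A B C"
  unfolding klein_det_def cmod_power2 by (simp add: power2_eq_square algebra_simps)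

text \<open>The cross product of the two Cayley images is, up to the positive factors of the denominators,
  the imaginary part computed in \<open>Im_cayley_cross_product\<close>.\<close>

lemma horientation_eq:
  assumes "Im A > 0" "Im B > 0" "Im C > 0"
  shows "horientation A B C = sgn (klein_det A B C)"
proof -
  have nz: "B - cnj A \<noteq> 0" "C - cnj A \<noteq> 0" using assms by (auto simp: complex_eq_iff)
  let ?k = "(cmod (B - cnj A))\<^sup>2 * (cmod (C - cnj A))\<^sup>2"
  let ?c = "\<lambda>z. (z - A) / (z - cnj A)"
  have c: "?c z = (z - A) * cnj (z - cnj A) / of_real ((cmod (z - cnj A))\<^sup>2)" for z
    by (simp only: complex_norm_square) (cases "z - cnj A = 0", auto)
  have cross: "Re z * Im w - Im z * Re w = Im (cnj z * w)" for z w
    by simp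
  have "Re (?c B) * Im (?c C) - Im (?c B) * Re (?c C) = Im (cnj (?c B) * ?c C)"
    by (rule cross)
  also have "cnj (?c B) * ?c C = (cnj ((B - A) * cnj (B - cnj A)) * ((C - A) * cnj (C - cnj A))) / of_real ?k"
    unfolding c by simp
  also have "Im \<dots> = 2 * Im A * klein_det A B C / ?k"
    unfolding Im_divide_of_real Im_cayley_cross_product by simp
  finally have "horientation A B C = sgn (2 * Im A * klein_det A B C / ?k)"
    unfolding horientation_def Let_def by simp
  also have "\<dots> = sgn (klein_det A B C)"
    using assms nz by (simp add: sgn_mult sgn_divide)
  finally show ?thesis .
qed

section \<open>Hyperbolic area above a geodesic arc\<close>

text \<open>Lets \<open>1 / (Im z)\<^sup>2\<close> be integrated over vertical slices first.\<close>

lemma lborel_complex: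
  "(lborel :: complex measure) = distr (lborel \<Otimes>\<^sub>M lborel) borel (\<lambda>(x, y). Complex x y)"
proof (rule lborel_eqI)
  have meas: "(\<lambda>(x, y). Complex x y) \<in> borel_measurable (lborel \<Otimes>\<^sub>M lborel)"
    unfolding complex_eq_iff Complex_eq by measurable
  fix l u :: complex assume le: "\<And>b. b \<in> Basis \<Longrightarrow> l \<bullet> b \<le> u \<bullet> b"
  have le': "Re l \<le> Re u" "Im l \<le> Im u"
    using le[of 1] le[of \<i>] by (auto simp: Basis_complex_def)
  have "(\<lambda>(x, y). Complex x y) -` box l u \<inter> space (lborel \<Otimes>\<^sub>M lborel) = box (Re l) (Re u) \<times> box (Im l) (Im u)"
    by (auto simp: in_box_complex_iff box_real space_pair_measure)
  then have "emeasure (distr (lborel \<Otimes>\<^sub>M lborel) borel (\<lambda>(x, y). Complex x y)) (box l u)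
     = emeasure lborel (box (Re l) (Re u)) * emeasure lborel (box (Im l) (Im u))"
    using meas by (simp add: emeasure_distr lborel.emeasure_pair_measure_Times)
  also have "\<dots> = ennreal (prod ((\<bullet>) (u - l)) Basis)"
    using le' by (simp add: box_real Basis_complex_def ennreal_mult[symmetric])
  finally show "emeasure (distr (lborel \<Otimes>\<^sub>M lborel) borel (\<lambda>(x, y). Complex x y)) (box l u)
     = ennreal (prod ((\<bullet>) (u - l)) Basis)" .
qed simp

lemma nn_integral_lborel_complex:
  assumes "f \<in> borel_measurable borel"
  shows "(\<integral>\<^sup>+ z. f z \<partial>lborel) = (\<integral>\<^sup>+ x. (\<integral>\<^sup>+ y. f (Complex x y) \<partial>lborel) \<partial>lborel)"
proof -
  have meas: "(\<lambda>(x, y). Complex x y) \<in> borel_measurable (lborel \<Otimes>\<^sub>M lborel)"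
    unfolding Complex_eq by measurable
  have "(\<integral>\<^sup>+ z. f z \<partial>lborel) = (\<integral>\<^sup>+ q. f (case q of (x, y) \<Rightarrow> Complex x y) \<partial>(lborel \<Otimes>\<^sub>M lborel))"
    unfolding lborel_complex by (rule nn_integral_distr[OF meas]) (simp add: assms)
  also have "\<dots> = (\<integral>\<^sup>+ x. (\<integral>\<^sup>+ y. f (Complex x y) \<partial>lborel) \<partial>lborel)"
    using measurable_compose[OF meas assms]
    by (subst lborel.nn_integral_fst[symmetric]) (simp_all add: case_prod_unfold)
  finally show ?thesis .
qed

text \<open>The geodesic through \<open>A\<close> and \<open>B\<close> is the preimage under \<open>klein\<close> of a line.  This is the square
  of its height above the real axis at abscissa \<open>x\<close>, meaningful when \<open>Re A \<noteq> Re B\<close>.\<close>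

definition arc_height2 :: "complex \<Rightarrow> complex \<Rightarrow> real \<Rightarrow> real" where
  "arc_height2 A B x = (cmod A)\<^sup>2 + ((cmod B)\<^sup>2 - (cmod A)\<^sup>2) / (Re B - Re A) * (x - Re A) - x\<^sup>2"

lemma arc_height2_pos:
  assumes "Im A > 0" "Im B > 0" "Re A < Re B" "Re A \<le> x" "x \<le> Re B"
  shows "arc_height2 A B x > 0"
proof -
  define d where "d = Re B - Re A"
  have d: "d > 0" using assms by (simp add: d_def)
  have "d * arc_height2 A B x = d * ((cmod A)\<^sup>2 - x\<^sup>2) + ((cmod B)\<^sup>2 - (cmod A)\<^sup>2) * (x - Re A)"
    using d unfolding arc_height2_def d_def[symmetric] by (simp add: field_simps)
  also have "\<dots> = (Re B - x) * (Im A)\<^sup>2 + (x - Re A) * (Im B)\<^sup>2 + (x - Re A) * (Re B - x) * d"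
    unfolding cmod_power2 d_def by algebra
  also have "\<dots> > 0"
  proof -
    have "(Re B - x) * (Im A)\<^sup>2 + (x - Re A) * (Im B)\<^sup>2 > 0"
      using assms by (cases "x = Re A") (auto intro!: add_nonneg_pos)
    then show ?thesis using assms d by (simp add: add_pos_nonneg)
  qed
  finally show ?thesis using d by (simp add: zero_less_mult_iff)
qed

lemma arc_height2_ends:
  assumes "Re A < Re B"
  shows "arc_height2 A B (Re A) = (Im A)\<^sup>2" "arc_height2 A B (Re B) = (Im B)\<^sup>2"
  using assms by (simp_all add: arc_height2_def cmod_power2)

text \<open>The antiderivative is the edge angle from \<open>A\<close> to the moving point of the arc, doubled.  The
  check uses that with \<open>y\<^sup>2 = arc_height2 A B x\<close> the quantity \<open>y\<^sup>2 + x\<^sup>2\<close> is affine in \<open>x\<close> with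
  slope \<open>m\<close> and the value \<open>(cmod A)\<^sup>2\<close> at \<open>Re A\<close>.\<close>

lemma arc_antiderivative:
  assumes A: "Im A > 0" and B: "Im B > 0" and x: "Re A < Re B" "Re A \<le> x" "x \<le> Re B"
  shows "((\<lambda>x. 2 * arctan ((x - Re A) / (sqrt (arc_height2 A B x) + Im A))) has_real_derivative
    1 / sqrt (arc_height2 A B x)) (at x)"
proof -
  define m where "m = ((cmod B)\<^sup>2 - (cmod A)\<^sup>2) / (Re B - Re A)"
  define y where "y = sqrt (arc_height2 A B x)"
  have y: "y > 0" "y\<^sup>2 = arc_height2 A B x" using arc_height2_pos[OF assms] by (simp_all add: y_def)
  have h: "arc_height2 A B = (\<lambda>x. (cmod A)\<^sup>2 + m * (x - Re A) - x\<^sup>2)"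
    by (simp add: fun_eq_iff arc_height2_def m_def)
  define t where "t = (x - Re A) / (y + Im A)"
  define dy where "dy = (m - 2 * x) / (2 * y)"
  have dh: "(arc_height2 A B has_real_derivative (m - 2 * x)) (at x)"
    unfolding h by (auto intro!: derivative_eq_intros)
  have ds: "((\<lambda>x. sqrt (arc_height2 A B x)) has_real_derivative dy) (at x)"
    
    using DERIV_chain2[OF DERIV_real_sqrt[OF arc_height2_pos[OF assms]] dh] by (simp add: dy_def y_def field_simps)
  have nz: "y + Im A \<noteq> 0" using y A by simp
  define g where "g = (\<lambda>x. sqrt (arc_height2 A B x))"
  have dg: "(g has_real_derivative dy) (at x)" "g x = y" using ds by (simp_all add: g_def y_def)
  have "((\<lambda>x. 2 * arctan ((x - Re A) / (g x + Im A))) has_real_derivative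
     2 * (((y + Im A) - (x - Re A) * dy) / (y + Im A)\<^sup>2 * inverse (1 + t\<^sup>2))) (at x)"
    using nz by (auto intro!: derivative_eq_intros dg(1) simp: dg(2) t_def power2_eq_square)
  moreover have "2 * (((y + Im A) - (x - Re A) * dy) / (y + Im A)\<^sup>2 * inverse (1 + t\<^sup>2)) = 1 / y"
  proof -
    have "(y + Im A)\<^sup>2 * (1 + t\<^sup>2) = (y + Im A)\<^sup>2 + (x - Re A)\<^sup>2"
      using nz by (simp add: t_def power_divide field_simps)
    then have "2 * (((y + Im A) - (x - Re A) * dy) / (y + Im A)\<^sup>2 * inverse (1 + t\<^sup>2)) =
      2 * ((y + Im A) - (x - Re A) * dy) / ((y + Im A)\<^sup>2 + (x - Re A)\<^sup>2)"
      by (simp add: divide_inverse mult.assoc flip: inverse_mult_distrib)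
    also have "\<dots> = 1 / y"
    proof -
      have "(y + Im A)\<^sup>2 + (x - Re A)\<^sup>2 > 0" using y A by (intro add_pos_nonneg) auto
      moreover have "2 * ((y + Im A) - (x - Re A) * dy) * y = (y + Im A)\<^sup>2 + (x - Re A)\<^sup>2"
      proof -
        have "2 * ((y + Im A) - (x - Re A) * dy) * y = 2 * y * (y + Im A) - (x - Re A) * (m - 2 * x)"
          using y by (simp add: dy_def field_simps)
        moreover have "y\<^sup>2 = (Re A)\<^sup>2 + (Im A)\<^sup>2 + m * (x - Re A) - x\<^sup>2"
          using y(2) by (simp add: h cmod_power2)
        ultimately show ?thesis by algebra
      qed
      ultimately show ?thesis using y nz by (simp add: divide_eq_eq eq_divide_eq)
    qed
    finally show ?thesis .
  qed
  ultimately show ?thesis by (simp add: y_def g_def)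
qed

lemma nn_integral_inverse_square_tail:
  assumes "k > 0"
  shows "(\<integral>\<^sup>+ y. indicator {k..} y * ennreal (1 / y\<^sup>2) \<partial>lborel) = ennreal (1 / k)"
proof -
  have "(\<integral>\<^sup>+ y. ennreal (1 / y\<^sup>2) * indicator {k..} y \<partial>lborel) = ennreal (0 - (- 1 / k))"
  proof (rule nn_integral_FTC_atLeast)
    show "((\<lambda>y. - 1 / y) has_real_derivative 1 / y\<^sup>2) (at y)" if "k \<le> y" for y
      using that assms by (auto intro!: derivative_eq_intros simp: power2_eq_square)
    show "((\<lambda>y::real. - 1 / y) \<longlongrightarrow> 0) at_top"
      by (intro tendsto_divide_0[OF tendsto_const] filterlim_at_top_imp_at_infinity filterlim_ident)
  qed auto
  then show ?thesis by (simp add: mult.commute)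
qed

text \<open>The two conditions leave open whether points of the arc itself belong to \<open>U\<close>, so that the lemma
  covers both the closed and the open region.  Vertical integration of \<open>1 / y\<^sup>2\<close> from the arc
  upwards gives the reciprocal of the height, whose antiderivative is known.\<close>

lemma nn_integral_above_arc:
  assumes A: "Im A > 0" and B: "Im B > 0" and AB: "Re A \<le> Re B" and U: "U \<in> sets borel"
    and below: "\<And>z. z \<in> U \<Longrightarrow> Re A < Re z \<and> Re z < Re B \<and> Im z > 0 \<and> arc_height2 A B (Re z) \<le> (Im z)\<^sup>2"
    and above: "\<And>z. Re A < Re z \<Longrightarrow> Re z < Re B \<Longrightarrow> Im z > 0 \<Longrightarrow> arc_height2 A B (Re z) < (Im z)\<^sup>2 \<Longrightarrow> z \<in> U"
  shows "(\<integral>\<^sup>+ z. indicator U z * ennreal (1 / (Im z)\<^sup>2) \<partial>lborel) = ennreal (2 * edge_angle A B)"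
proof (cases "Re A = Re B")
  case True
  then have "U = {}" using below by force
  then show ?thesis using True by (simp add: edge_angle_def)
next
  case False
  with AB have lt: "Re A < Re B" by simp
  let ?h = "arc_height2 A B"
  have pos: "?h x > 0" if "Re A \<le> x" "x \<le> Re B" for x using arc_height2_pos[OF A B lt] that by simp
  have [measurable]: "?h \<in> borel_measurable borel" unfolding arc_height2_def by measurable
  have inner: "(\<integral>\<^sup>+ y. indicator U (Complex x y) * ennreal (1 / (Im (Complex x y))\<^sup>2) \<partial>lborel) =
      ennreal (1 / sqrt (?h x)) * indicator {Re A..Re B} x" if x: "x \<noteq> Re A" "x \<noteq> Re B" for x
  proof (cases "Re A < x \<and> x < Re B")
    case True
    then have k: "sqrt (?h x) > 0" using pos by simp
    have iff: "Complex x y \<in> U \<longleftrightarrow> sqrt (?h x) \<le> y" if "y \<noteq> sqrt (?h x)" for y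
    proof
      assume "Complex x y \<in> U"
      with below have "0 < y" "?h x \<le> y\<^sup>2" by fastforce+
      then show "sqrt (?h x) \<le> y" by (simp add: real_le_lsqrt)
    next
      assume "sqrt (?h x) \<le> y"
      with that k have "sqrt (?h x) < y" "y > 0" by linarith+
      moreover have "?h x < y\<^sup>2"
        using power_strict_mono[OF \<open>sqrt (?h x) < y\<close>, of 2] k by simp
      ultimately show "Complex x y \<in> U" using above True by simp
    qed
    have "(\<integral>\<^sup>+ y. indicator U (Complex x y) * ennreal (1 / (Im (Complex x y))\<^sup>2) \<partial>lborel) =
       (\<integral>\<^sup>+ y. indicator {sqrt (?h x)..} y * ennreal (1 / y\<^sup>2) \<partial>lborel)"
      using AE_lborel_singleton[of "sqrt (?h x)"]
      by (intro nn_integral_cong_AE, eventually_elim) (auto simp: indicator_def iff)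
    then show ?thesis using nn_integral_inverse_square_tail[OF k] True by simp
  next
    case False
    then have "Complex x y \<notin> U" for y using below by force
    moreover have "x \<notin> {Re A..Re B}" using False x by auto
    ultimately show ?thesis by simp
  qed
  have "(\<integral>\<^sup>+ z. indicator U z * ennreal (1 / (Im z)\<^sup>2) \<partial>lborel) =
     (\<integral>\<^sup>+ x. (\<integral>\<^sup>+ y. indicator U (Complex x y) * ennreal (1 / (Im (Complex x y))\<^sup>2) \<partial>lborel) \<partial>lborel)"
    using U by (intro nn_integral_lborel_complex borel_measurable_times_ennreal borel_measurable_indicator
        measurable_compose[OF _ measurable_ennreal]
        borel_measurable_divide borel_measurable_power borel_measurable_continuous_onI continuous_intros)
  also have "\<dots> = (\<integral>\<^sup>+ x. ennreal (1 / sqrt (?h x)) * indicator {Re A..Re B} x \<partial>lborel)"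
    using AE_lborel_singleton[of "Re A"] AE_lborel_singleton[of "Re B"]
    by (intro nn_integral_cong_AE, eventually_elim) (rule inner)
  also have "\<dots> = ennreal (2 * arctan ((Re B - Re A) / (sqrt (?h (Re B)) + Im A))
      - 2 * arctan ((Re A - Re A) / (sqrt (?h (Re A)) + Im A)))"
    using pos by (intro nn_integral_FTC_Icc arc_antiderivative A B lt) (auto intro!: less_imp_le AB)
  also have "\<dots> = ennreal (2 * edge_angle A B)"
    using B lt by (simp add: arc_height2_ends edge_angle_def add.commute)
  finally show ?thesis .
qed

section \<open>Hyperbolic area of a triangle\<close>

text \<open>The ordinate at \<open>x\<close> of the line through \<open>a\<close> and \<open>b\<close>.\<close>

definition chord :: "real \<times> real \<Rightarrow> real \<times> real \<Rightarrow> real \<Rightarrow> real" where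
  "chord a b x = snd a + (snd b - snd a) / (fst b - fst a) * (x - fst a)"

text \<open>A vertical line to the left of the middle vertex meets the triangle in the segment between the
  two sides at \<open>a\<close>.  With barycentric coordinates \<open>1 - v - w\<close>, \<open>v\<close>, \<open>w\<close> the conditions
  \<open>0 \<le> v\<close> and \<open>0 \<le> w\<close> are the comparisons with the chords \<open>a c\<close> and \<open>a b\<close>; the third condition
  holds automatically at this abscissa.\<close>

lemma triangle_slice_left:
  fixes a b c q :: "real \<times> real"
  defines "d \<equiv> (fst b - fst a) * (snd c - snd a) - (fst c - fst a) * (snd b - snd a)"
  assumes x: "fst a < fst q" "fst q < fst b" "fst b \<le> fst c" and d: "d \<noteq> 0"
  shows "q \<in> convex hull {a, b, c} \<longleftrightarrow>
      (if d < 0 then chord a c (fst q) \<le> snd q \<and> snd q \<le> chord a b (fst q)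
       else chord a b (fst q) \<le> snd q \<and> snd q \<le> chord a c (fst q))"
    and "if d < 0 then chord a c (fst q) < chord a b (fst q) else chord a b (fst q) < chord a c (fst q)"
proof -
  define x1 s1 x2 s2 x3 s3 x0 s0 where xs: "x1 = fst a" "s1 = snd a" "x2 = fst b" "s2 = snd b"
    "x3 = fst c" "s3 = snd c" "x0 = fst q" "s0 = snd q"
  have abc: "a = (x1, s1)" "b = (x2, s2)" "c = (x3, s3)" "q = (x0, s0)"
    by (simp_all add: xs)
  note [simp] = abc
  have lt: "x1 < x0" "x0 < x2" "x2 \<le> x3" "x1 < x2" "x1 < x3" using x by auto
  have dd: "d = (x2 - x1) * (s3 - s1) - (x3 - x1) * (s2 - s1)" by (simp add: d_def)
  define v w where "v = ((x0 - x1) * (s3 - s1) - (s0 - s1) * (x3 - x1)) / d"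
    and "w = ((s0 - s1) * (x2 - x1) - (x0 - x1) * (s2 - s1)) / d"
  have ac: "(x3 - x1) * chord a c x0 = (x3 - x1) * s1 + (s3 - s1) * (x0 - x1)"
    and ab: "(x2 - x1) * chord a b x0 = (x2 - x1) * s1 + (s2 - s1) * (x0 - x1)"
    using lt(4,5) by (simp_all add: chord_def distrib_left)
  have vd: "v * d = (x3 - x1) * (chord a c x0 - s0)"
    using ac d by (simp add: v_def right_diff_distrib) (simp add: algebra_simps)
  have wd: "w * d = (x2 - x1) * (s0 - chord a b x0)"
    using ab d by (simp add: w_def right_diff_distrib) (simp add: algebra_simps)
  have "d * (x0 - x1) = (v * d) * (x2 - x1) + (w * d) * (x3 - x1)"
    using d by (simp add: v_def w_def) (simp add: dd algebra_simps)
  then have "d * (x0 - x1) = d * (v * (x2 - x1) + w * (x3 - x1))" by (simp add: algebra_simps)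
  then have bx: "x0 - x1 = v * (x2 - x1) + w * (x3 - x1)" by (rule mult_left_cancel[OF d, THEN iffD1])
  have "d * (s0 - s1) = (v * d) * (s2 - s1) + (w * d) * (s3 - s1)"
    using d by (simp add: v_def w_def) (simp add: dd algebra_simps)
  then have "d * (s0 - s1) = d * (v * (s2 - s1) + w * (s3 - s1))" by (simp add: algebra_simps)
  then have bs: "s0 - s1 = v * (s2 - s1) + w * (s3 - s1)" by (rule mult_left_cancel[OF d, THEN iffD1])
  have "q \<in> convex hull {a, b, c} \<longleftrightarrow> 0 \<le> v \<and> 0 \<le> w"
  proof
    assume "q \<in> convex hull {a, b, c}"
    then obtain u' v' w' where uvw: "0 \<le> v'" "0 \<le> w'" "u' + v' + w' = 1"
      and q: "x0 = u' * x1 + v' * x2 + w' * x3" "s0 = u' * s1 + v' * s2 + w' * s3"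
      unfolding convex_hull_3 by auto
    have u': "u' = 1 - v' - w'" using uvw by simp
    have "(x0 - x1) * (s3 - s1) - (s0 - s1) * (x3 - x1) = v' * d"
      "(s0 - s1) * (x2 - x1) - (x0 - x1) * (s2 - s1) = w' * d"
      unfolding q u' dd by algebra+
    then have "v = v'" "w = w'" using d by (simp_all add: v_def w_def)
    then show "0 \<le> v \<and> 0 \<le> w" using uvw by simp
  next
    assume vw: "0 \<le> v \<and> 0 \<le> w"
    have "v + w \<le> 1"
    proof (rule ccontr)
      assume "\<not> v + w \<le> 1"
      then have "x2 - x1 < (v + w) * (x2 - x1)" using lt by simp
      also have "\<dots> \<le> v * (x2 - x1) + w * (x3 - x1)"
        using vw lt by (simp add: distrib_right mult_left_mono)
      finally show False using bx lt by simp
    qed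
    moreover have "x0 = (1 - v - w) * x1 + v * x2 + w * x3" "s0 = (1 - v - w) * s1 + v * s2 + w * s3"
      using bx bs by (simp_all add: algebra_simps)
    ultimately have "q = (1 - v - w) *\<^sub>R a + v *\<^sub>R b + w *\<^sub>R c \<and> 0 \<le> 1 - v - w \<and> 0 \<le> v \<and> 0 \<le> w \<and> (1 - v - w) + v + w = 1"
      using vw by simp
    then show "q \<in> convex hull {a, b, c}"
      unfolding convex_hull_3 by blast
  qed
  moreover have "0 \<le> v \<longleftrightarrow> (if d < 0 then chord a c x0 \<le> s0 else s0 \<le> chord a c x0)"
  proof -
    have "0 \<le> v \<longleftrightarrow> (if d < 0 then v * d \<le> 0 else 0 \<le> v * d)"
      using d by (auto simp: zero_le_mult_iff mult_le_0_iff)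
    then show ?thesis unfolding vd using lt by (simp add: zero_le_mult_iff mult_le_0_iff)
  qed
  moreover have "0 \<le> w \<longleftrightarrow> (if d < 0 then s0 \<le> chord a b x0 else chord a b x0 \<le> s0)"
  proof -
    have "0 \<le> w \<longleftrightarrow> (if d < 0 then w * d \<le> 0 else 0 \<le> w * d)"
      using d by (auto simp: zero_le_mult_iff mult_le_0_iff)
    then show ?thesis unfolding wd using lt by (simp add: zero_le_mult_iff mult_le_0_iff)
  qed
  ultimately show "q \<in> convex hull {a, b, c} \<longleftrightarrow>
      (if d < 0 then chord a c (fst q) \<le> snd q \<and> snd q \<le> chord a b (fst q)
       else chord a b (fst q) \<le> snd q \<and> snd q \<le> chord a c (fst q))" by auto
  have "(x2 - x1) * ((x3 - x1) * chord a c x0) - (x3 - x1) * ((x2 - x1) * chord a b x0) = (x0 - x1) * d"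
    unfolding ac ab dd by algebra
  then have "((x2 - x1) * (x3 - x1)) * (chord a c x0 - chord a b x0) = (x0 - x1) * d"
    by (simp add: algebra_simps)
  then have "sgn ((x2 - x1) * (x3 - x1)) * sgn (chord a c x0 - chord a b x0) = sgn (x0 - x1) * sgn d"
    by (simp only: sgn_mult[symmetric])
  then have "sgn (chord a c x0 - chord a b x0) = sgn d" using lt by (simp add: sgn_mult)
  then show "if d < 0 then chord a c (fst q) < chord a b (fst q) else chord a b (fst q) < chord a c (fst q)"
    using d by (auto simp: sgn_if split: if_splits)
qed

text \<open>Reflection in the vertical axis reduces slices to the right of the middle vertex to slices to
  the left of it.\<close>

lemma convex_hull_reflect:
  fixes a b c q :: "real \<times> real"
  defines "r \<equiv> \<lambda>p. (- fst p, snd p)"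
  shows "r q \<in> convex hull {r c, r b, r a} \<longleftrightarrow> q \<in> convex hull {a, b, c}"
proof -
  have *: "r q \<in> convex hull {r c, r b, r a}" if "q \<in> convex hull {a, b, c}" for q a b c
  proof -
    have "linear r" unfolding r_def by (auto intro!: linearI)
    then have "convex hull (r ` {a, b, c}) = r ` (convex hull {a, b, c})" by (rule convex_hull_linear_image[symmetric])
    moreover have "r ` {a, b, c} = {r c, r b, r a}" by auto
    ultimately show ?thesis using imageI[OF that, of r] by simp
  qed
  have rr: "r (r p) = p" for p by (simp add: r_def)
  show ?thesis
    using *[of q a b c] *[of "r q" "r c" "r b" "r a"] unfolding rr by blast
qed

lemma triangle_slice_right:
  fixes a b c q :: "real \<times> real"
  defines "d \<equiv> (fst b - fst a) * (snd c - snd a) - (fst c - fst a) * (snd b - snd a)"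
  assumes x: "fst a \<le> fst b" "fst b < fst q" "fst q < fst c" and d: "d \<noteq> 0"
  shows "q \<in> convex hull {a, b, c} \<longleftrightarrow>
      (if d < 0 then chord a c (fst q) \<le> snd q \<and> snd q \<le> chord b c (fst q)
       else chord b c (fst q) \<le> snd q \<and> snd q \<le> chord a c (fst q))"
    and "if d < 0 then chord a c (fst q) < chord b c (fst q) else chord b c (fst q) < chord a c (fst q)"
proof -
  let ?r = "\<lambda>p::real\<times>real. (- fst p, snd p)"
  have ch: "chord (?r v) (?r u) (- x) = chord u v x" if "fst u < fst v" for u v x
    using that by (simp add: chord_def field_simps)
  have d': "(fst (?r b) - fst (?r c)) * (snd (?r a) - snd (?r c)) - (fst (?r a) - fst (?r c)) * (snd (?r b) - snd (?r c)) = d"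
    by (simp add: d_def algebra_simps)
  note L = triangle_slice_left[of "?r c" "?r q" "?r b" "?r a", unfolded d' convex_hull_reflect]
  show "q \<in> convex hull {a, b, c} \<longleftrightarrow>
      (if d < 0 then chord a c (fst q) \<le> snd q \<and> snd q \<le> chord b c (fst q)
       else chord b c (fst q) \<le> snd q \<and> snd q \<le> chord a c (fst q))"
    using L(1) x d ch[of a c "fst q"] ch[of b c "fst q"] by (cases "d < 0") simp_all
  show "if d < 0 then chord a c (fst q) < chord b c (fst q) else chord b c (fst q) < chord a c (fst q)"
    using L(2) x d ch[of a c "fst q"] ch[of b c "fst q"] by (cases "d < 0") simp_all
qed

lemma triangle_fst_bounds:
  fixes a b c q :: "real \<times> real"
  assumes "q \<in> convex hull {a, b, c}" "fst a \<le> fst b" "fst b \<le> fst c"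
  shows "fst a \<le> fst q" "fst q \<le> fst c"
proof -
  obtain u v w where uvw: "0 \<le> u" "0 \<le> v" "0 \<le> w" "u + v + w = 1" and q: "q = u *\<^sub>R a + v *\<^sub>R b + w *\<^sub>R c"
    using assms(1) unfolding convex_hull_3 by blast
  have u: "u = 1 - v - w" using uvw(4) by simp
  have "fst q - fst a = v * (fst b - fst a) + w * (fst c - fst a)"
    unfolding q u by (simp add: algebra_simps)
  moreover have "\<dots> \<ge> 0" using assms(2,3) uvw by (intro add_nonneg_nonneg mult_nonneg_nonneg) auto
  ultimately show "fst a \<le> fst q" by simp
  have w: "w = 1 - u - v" using uvw(4) by simp
  have "fst c - fst q = u * (fst c - fst a) + v * (fst c - fst b)"
    unfolding q w by (simp add: algebra_simps)
  moreover have "\<dots> \<ge> 0" using assms(2,3) uvw by (intro add_nonneg_nonneg mult_nonneg_nonneg) auto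
  ultimately show "fst q \<le> fst c" by simp
qed

lemma htriangle_klein:
  assumes "Im A > 0" "Im B > 0" "Im C > 0"
  shows "z \<in> htriangle A B C \<longleftrightarrow> Im z > 0 \<and> klein z \<in> convex hull {klein A, klein B, klein C}"
  using hconvex_hull_klein[of "{A, B, C}"] assms by (auto simp: htriangle_def upper_half_plane_def)

lemma htriangle_borel:
  assumes "Im A > 0" "Im B > 0" "Im C > 0"
  shows "htriangle A B C \<in> sets borel"
proof -
  have "closed (convex hull {klein A, klein B, klein C})"
    by (intro compact_imp_closed compact_convex_hull finite_imp_compact) auto
  then have "closed (klein -` (convex hull {klein A, klein B, klein C}))"
    by (intro closed_vimage) (auto simp: klein_def intro!: continuous_intros)
  moreover have "open {z. Im z > 0}" by (intro open_Collect_less continuous_intros)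
  moreover have "htriangle A B C = {z. Im z > 0} \<inter> klein -` (convex hull {klein A, klein B, klein C})"
    by (simp add: set_eq_iff htriangle_klein[OF assms])
  ultimately show ?thesis by simp
qed

lemma chord_klein: "chord (klein A) (klein B) x = arc_height2 A B x + x\<^sup>2"
  by (simp add: chord_def klein_def arc_height2_def)

definition above_arc :: "complex \<Rightarrow> complex \<Rightarrow> complex set" where
  "above_arc A B = {z. Re A < Re z \<and> Re z < Re B \<and> 0 < Im z \<and> arc_height2 A B (Re z) \<le> (Im z)\<^sup>2}"

definition strictly_above_arc :: "complex \<Rightarrow> complex \<Rightarrow> complex set" where
  "strictly_above_arc A B = {z. Re A < Re z \<and> Re z < Re B \<and> 0 < Im z \<and> arc_height2 A B (Re z) < (Im z)\<^sup>2}"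

lemma above_arc_borel: "above_arc A B \<in> sets borel" "strictly_above_arc A B \<in> sets borel"
proof -
  have [measurable]: "Re \<in> borel_measurable borel" "Im \<in> borel_measurable borel"
    by (intro borel_measurable_continuous_onI continuous_intros)+
  have [measurable]: "arc_height2 A B \<in> borel_measurable borel"
    unfolding arc_height2_def by measurable
  have "above_arc A B = {z \<in> space borel. Re A < Re z \<and> Re z < Re B \<and> 0 < Im z \<and> arc_height2 A B (Re z) \<le> (Im z)\<^sup>2}"
    "strictly_above_arc A B = {z \<in> space borel. Re A < Re z \<and> Re z < Re B \<and> 0 < Im z \<and> arc_height2 A B (Re z) < (Im z)\<^sup>2}"
    by (auto simp: above_arc_def strictly_above_arc_def)
  then show "above_arc A B \<in> sets borel" "strictly_above_arc A B \<in> sets borel"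
    by (simp_all only:) measurable
qed

lemma AE_Re_neq: "AE z in lborel. Re z \<noteq> c"
proof -
  have "negligible {z::complex. z \<bullet> 1 = c}"
    by (rule negligible_standard_hyperplane) (simp add: Basis_complex_def)
  then have "{z::complex. z \<bullet> 1 = c} \<in> null_sets lebesgue"
    by (simp add: negligible_iff_null_sets)
  moreover have "{z::complex. z \<bullet> 1 = c} = {z. Re z = c}" by auto
  moreover have "{z. Re z = c} \<in> sets borel"
    by (intro borel_closed closed_Collect_eq continuous_intros)
  ultimately have "{z. Re z = c} \<in> null_sets lborel"
    by (simp add: null_sets_completion_iff)
  then show ?thesis by (rule AE_I') auto
qed

text \<open>Between the abscissas of consecutive vertices the triangle is bounded by the side \<open>A C\<close> and one
  of the two other sides, and the sign of the determinant tells whether \<open>B\<close> lies above or below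
  \<open>A C\<close>.  The triangle contains both boundary arcs, so the region subtracted from the closed region
  above the lower arc is the open region above the upper one.  On the vertical lines through the
  vertices the identity may fail, but these are null sets.\<close>

lemma area_decomposition:
  assumes pos: "Im A > 0" "Im B > 0" "Im C > 0" and ord: "Re A \<le> Re B" "Re B \<le> Re C"
    and z: "Re z \<noteq> Re A" "Re z \<noteq> Re B" "Re z \<noteq> Re C"
  shows "klein_det A B C < 0 \<Longrightarrow>
      indicator (htriangle A B C) z + (indicator (strictly_above_arc A B) z + indicator (strictly_above_arc B C) z)
      = (indicator (above_arc A C) z :: ennreal)"
    and "klein_det A B C > 0 \<Longrightarrow>
      indicator (htriangle A B C) z + indicator (strictly_above_arc A C) z
      = (indicator (above_arc A B) z + indicator (above_arc B C) z :: ennreal)"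
proof -
  let ?a = "klein A" and ?b = "klein B" and ?c = "klein C" and ?q = "klein z"
  have d: "(fst ?b - fst ?a) * (snd ?c - snd ?a) - (fst ?c - fst ?a) * (snd ?b - snd ?a) = klein_det A B C"
    by (simp add: klein_def klein_det_def)
  have s: "snd ?q = (Im z)\<^sup>2 + (Re z)\<^sup>2" by (simp add: klein_def cmod_power2)
  note T = htriangle_klein[OF pos, of z]
  note L = triangle_slice_left[of ?a ?q ?b ?c, unfolded d] and R = triangle_slice_right[of ?a ?b ?q ?c, unfolded d]
  note bnd = triangle_fst_bounds[of ?q ?a ?b ?c]
  have f: "fst (klein w) = Re w" for w by (simp add: klein_def)
  consider "Im z \<le> 0" | "Re z < Re A \<or> Re C < Re z" | "Im z > 0" "Re A < Re z" "Re z < Re B"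
    | "Im z > 0" "Re B < Re z" "Re z < Re C" using z by linarith
  note cases = this
  show "indicator (htriangle A B C) z + (indicator (strictly_above_arc A B) z + indicator (strictly_above_arc B C) z)
      = (indicator (above_arc A C) z :: ennreal)" if D: "klein_det A B C < 0"
  proof (cases rule: cases)
    case 1 then show ?thesis using T by (auto simp: indicator_def above_arc_def strictly_above_arc_def)
  next
    case 2 then show ?thesis using T bnd ord by (auto simp: indicator_def above_arc_def strictly_above_arc_def f)
  next
    case 3 then show ?thesis
      using T L ord D by (auto simp: indicator_def above_arc_def strictly_above_arc_def f chord_klein s)
  next
    case 4 then show ?thesis
      using T R ord D by (auto simp: indicator_def above_arc_def strictly_above_arc_def f chord_klein s)
  qed
  show "indicator (htriangle A B C) z + indicator (strictly_above_arc A C) z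
      = (indicator (above_arc A B) z + indicator (above_arc B C) z :: ennreal)" if D: "klein_det A B C > 0"
  proof (cases rule: cases)
    case 1 then show ?thesis using T by (auto simp: indicator_def above_arc_def strictly_above_arc_def)
  next
    case 2 then show ?thesis using T bnd ord by (auto simp: indicator_def above_arc_def strictly_above_arc_def f)
  next
    case 3 then show ?thesis
      using T L ord D by (auto simp: indicator_def above_arc_def strictly_above_arc_def f chord_klein s)
  next
    case 4 then show ?thesis
      using T R ord D by (auto simp: indicator_def above_arc_def strictly_above_arc_def f chord_klein s)
  qed
qed

text \<open>The hyperbolic area as an extended nonnegative number: areas above arcs can be added before
  anything is known about finiteness.\<close>

definition area_measure :: "complex set \<Rightarrow> ennreal" where
  "area_measure U = (\<integral>\<^sup>+ z. indicator U z * ennreal (1 / (Im z)\<^sup>2) \<partial>lborel)"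

lemma harea_eq_area_measure:
  assumes "T \<in> sets borel"
  shows "harea T = enn2real (area_measure T)"
proof -
  note [measurable] = assms
  have [measurable]: "Im \<in> borel_measurable borel"
    by (intro borel_measurable_continuous_onI continuous_intros)
  have "harea T = (LINT z|lborel. indicator T z * (1 / (Im z)\<^sup>2))"
    by (simp add: harea_def set_lebesgue_integral_def)
  also have "\<dots> = enn2real (\<integral>\<^sup>+ z. ennreal (indicator T z * (1 / (Im z)\<^sup>2)) \<partial>lborel)"
    by (rule integral_eq_nn_integral) auto
  also have "(\<integral>\<^sup>+ z. ennreal (indicator T z * (1 / (Im z)\<^sup>2)) \<partial>lborel) = area_measure T"
    unfolding area_measure_def by (intro nn_integral_cong) (simp add: indicator_def)
  finally show ?thesis .
qed

lemma area_measure_above_arc: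
  assumes "Im A > 0" "Im B > 0" "Re A \<le> Re B"
  shows "area_measure (above_arc A B) = ennreal (2 * edge_angle A B)"
    "area_measure (strictly_above_arc A B) = ennreal (2 * edge_angle A B)"
  unfolding area_measure_def
  by (intro nn_integral_above_arc assms above_arc_borel; auto simp: above_arc_def strictly_above_arc_def)+

lemma edge_angle_nonneg:
  assumes "Im A > 0" "Im B > 0" "Re A \<le> Re B"
  shows "edge_angle A B \<ge> 0"
  using assms by (simp add: edge_angle_def zero_le_arctan_iff)

lemma area_measure_add:
  assumes "U \<in> sets borel" "V \<in> sets borel"
  shows "area_measure U + area_measure V =
    (\<integral>\<^sup>+ z. (indicator U z + indicator V z) * ennreal (1 / (Im z)\<^sup>2) \<partial>lborel)"
proof -
  note [measurable] = assms
  have [measurable]: "Im \<in> borel_measurable borel"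
    by (intro borel_measurable_continuous_onI continuous_intros)
  show ?thesis
    unfolding area_measure_def distrib_right by (intro nn_integral_add[symmetric]) measurable
qed

text \<open>Integrate \<open>area_decomposition\<close>.  The case of collinear vertices needs no integration, since the
  orientation and the edge sum both vanish.\<close>

lemma signed_area_sorted:
  assumes pos: "Im A > 0" "Im B > 0" "Im C > 0" and ord: "Re A \<le> Re B" "Re B \<le> Re C"
  shows "signed_area A B C = 2 * edge_sum A B C"
proof -
  let ?w = "\<lambda>z. ennreal (1 / (Im z)\<^sup>2)"
  note [measurable] = htriangle_borel[OF pos] above_arc_borel
  have [measurable]: "Im \<in> borel_measurable borel"
    by (intro borel_measurable_continuous_onI continuous_intros)
  have AC: "Re A \<le> Re C" using ord by simp
  have e: "edge_angle A B \<ge> 0" "edge_angle B C \<ge> 0" "edge_angle A C \<ge> 0"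
    using edge_angle_nonneg pos ord AC by auto
  have sum: "edge_sum A B C = edge_angle A B + edge_angle B C - edge_angle A C"
    unfolding edge_sum_def edge_angle_swap[of C A] by simp
  let ?T = "htriangle A B C"
  have harea: "harea ?T = enn2real (area_measure ?T)" by (intro harea_eq_area_measure htriangle_borel pos)
  consider "klein_det A B C = 0" | "klein_det A B C < 0" | "klein_det A B C > 0" by linarith
  then show ?thesis
  proof cases
    case 1
    then show ?thesis using edge_sum_eq_0[OF pos] by (simp add: signed_area_def horientation_eq[OF pos])
  next
    case 2
    have "area_measure ?T + (area_measure (strictly_above_arc A B) + area_measure (strictly_above_arc B C)) =
      (\<integral>\<^sup>+ z. (indicator ?T z + (indicator (strictly_above_arc A B) z + indicator (strictly_above_arc B C) z)) * ?w z \<partial>lborel)"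
      unfolding area_measure_add[OF above_arc_borel(2) above_arc_borel(2)] distrib_right[of "indicator ?T _"]
      unfolding area_measure_def by (intro nn_integral_add[symmetric]) measurable
    also have "\<dots> = area_measure (above_arc A C)"
      unfolding area_measure_def
      using AE_Re_neq[of "Re A"] AE_Re_neq[of "Re B"] AE_Re_neq[of "Re C"]
      by (intro nn_integral_cong_AE, eventually_elim) (simp only: area_decomposition(1)[OF pos ord _ _ _ 2] not_False_eq_True)
    finally have eq: "area_measure ?T + ennreal (2 * edge_angle A B + 2 * edge_angle B C) = ennreal (2 * edge_angle A C)"
      using e by (simp add: area_measure_above_arc pos ord AC)
    obtain r where r: "r \<ge> 0" "area_measure ?T = ennreal r"
      using eq by (cases "area_measure ?T") auto
    then have "r + (2 * edge_angle A B + 2 * edge_angle B C) = 2 * edge_angle A C"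
      using eq e by (simp flip: ennreal_plus)
    then show ?thesis using r 2 by (simp add: signed_area_def horientation_eq[OF pos] harea sum)
  next
    case 3
    have "area_measure ?T + area_measure (strictly_above_arc A C) =
      (\<integral>\<^sup>+ z. (indicator ?T z + indicator (strictly_above_arc A C) z) * ?w z \<partial>lborel)"
      by (intro area_measure_add) measurable
    also have "\<dots> = (\<integral>\<^sup>+ z. (indicator (above_arc A B) z + indicator (above_arc B C) z) * ?w z \<partial>lborel)"
      using AE_Re_neq[of "Re A"] AE_Re_neq[of "Re B"] AE_Re_neq[of "Re C"]
      by (intro nn_integral_cong_AE, eventually_elim) (simp only: area_decomposition(2)[OF pos ord _ _ _ 3] not_False_eq_True)
    also have "\<dots> = area_measure (above_arc A B) + area_measure (above_arc B C)"
      by (intro area_measure_add[symmetric]) measurable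
    finally have eq: "area_measure ?T + ennreal (2 * edge_angle A C) = ennreal (2 * edge_angle A B + 2 * edge_angle B C)"
      using e by (simp add: area_measure_above_arc pos ord AC)
    obtain r where r: "r \<ge> 0" "area_measure ?T = ennreal r"
      using eq by (cases "area_measure ?T") auto
    then have "r + 2 * edge_angle A C = 2 * edge_angle A B + 2 * edge_angle B C"
      using eq e by (simp flip: ennreal_plus)
    then show ?thesis using r 3 by (simp add: signed_area_def horientation_eq[OF pos] harea sum)
  qed
qed

lemma signed_area_swap:
  assumes "Im A > 0" "Im B > 0" "Im C > 0"
  shows "signed_area B A C = - signed_area A B C" "signed_area A C B = - signed_area A B C"
proof -
  have D: "klein_det B A C = - klein_det A B C" "klein_det A C B = - klein_det A B C"
    by (simp_all add: klein_det_def algebra_simps)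
  have H: "htriangle B A C = htriangle A B C" "htriangle A C B = htriangle A B C"
    by (simp_all add: htriangle_def insert_commute)
  show "signed_area B A C = - signed_area A B C" "signed_area A C B = - signed_area A B C"
    using assms unfolding signed_area_def H
    by (simp_all add: horientation_eq D)
qed

lemma edge_sum_swap: "edge_sum B A C = - edge_sum A B C" "edge_sum A C B = - edge_sum A B C"
  unfolding edge_sum_def edge_angle_swap[of B A] edge_angle_swap[of C A] edge_angle_swap[of C B] by simp_all

text \<open>Both sides change sign under transpositions of the vertices, so the vertices may be sorted by
  their real parts.\<close>

lemma signed_area_eq_edge_sum:
  assumes "Im A > 0" "Im B > 0" "Im C > 0"
  shows "signed_area A B C = 2 * edge_sum A B C"
proof -
  have sw1: "signed_area P Q R = 2 * edge_sum P Q R"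
    if "signed_area Q P R = 2 * edge_sum Q P R" "Im P > 0" "Im Q > 0" "Im R > 0" for Q P R
    using that signed_area_swap(1)[of P Q R] edge_sum_swap(1)[of P Q R] by simp
  have sw2: "signed_area P Q R = 2 * edge_sum P Q R"
    if "signed_area P R Q = 2 * edge_sum P R Q" "Im P > 0" "Im Q > 0" "Im R > 0" for P R Q
    using that signed_area_swap(2)[of P Q R] edge_sum_swap(2)[of P Q R] by simp
  have AB: "signed_area P Q R = 2 * edge_sum P Q R"
    if "Re P \<le> Re Q" "Im P > 0" "Im Q > 0" "Im R > 0" for P Q R
  proof -
    consider "Re Q \<le> Re R" | "Re P \<le> Re R" "Re R \<le> Re Q" | "Re R \<le> Re P" by linarith
    then show ?thesis
    proof cases
      case 1 then show ?thesis using that signed_area_sorted by blast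
    next
      case 2
      then have "signed_area P R Q = 2 * edge_sum P R Q" using that signed_area_sorted by blast
      then show ?thesis using that by (intro sw2[of P R Q])
    next
      case 3
      then have "signed_area R P Q = 2 * edge_sum R P Q" using that signed_area_sorted by blast
      then have "signed_area P R Q = 2 * edge_sum P R Q" using that by (intro sw1[of R P Q])
      then show ?thesis using that by (intro sw2[of P R Q])
    qed
  qed
  show ?thesis
  proof (cases "Re A \<le> Re B")
    case True then show ?thesis using AB assms by blast
  next
    case False
    then have "signed_area B A C = 2 * edge_sum B A C" using AB assms by simp
    then show ?thesis using assms by (intro sw1[of B A C])
  qed
qed

section \<open>The defect of Milnor's angle function\<close>

text \<open>Starting from 0, a continuous angle cannot reach \<open>pi / 2\<close> in absolute value while its cosine
  stays positive.\<close>

lemma abs_less_pi_half_if_cos_pos_on: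
  fixes D :: "real \<Rightarrow> real"
  assumes D: "continuous_on {0..1} D" "D 0 = 0" and cos: "\<And>t. t \<in> {0..1} \<Longrightarrow> cos (D t) > 0"
  shows "\<bar>D 1\<bar> < pi / 2"
proof (rule ccontr)
  assume "\<not> \<bar>D 1\<bar> < pi / 2"
  moreover have "continuous_on {0..1} (\<lambda>t. \<bar>D t\<bar>)" using D(1) by (intro continuous_intros)
  ultimately obtain t where t: "0 \<le> t" "t \<le> 1" "\<bar>D t\<bar> = pi / 2"
    using IVT'[of "\<lambda>t. \<bar>D t\<bar>" 0 "pi / 2" 1] D(2) by auto
  have "cos \<bar>D t\<bar> = 0" unfolding t(3) by simp
  then have "cos (D t) = 0" by simp
  then show False using cos[of t] t by simp
qed

context universal_cover_SL2R
begin

lemma det_p: "x \<in> carrier G \<Longrightarrow> det (p x) = 1"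
  using hom by (auto simp: hom_def SL2R_def)

lemma p_mult: "x \<in> carrier G \<Longrightarrow> y \<in> carrier G \<Longrightarrow> p (x \<otimes> y) = p x ** p y"
  using hom by (auto simp: hom_def SL2R_def)

lemma p_one: "p \<one> = mat 1"
proof -
  have "p \<one> ** p \<one> = p \<one>" using p_mult[of \<one> \<one>] by simp
  moreover have "invertible (p \<one>)" using det_p[of \<one>] by (simp add: invertible_det_nz)
  ultimately show ?thesis
    by (metis invertible_def matrix_mul_assoc matrix_mul_lid)
qed

lemma path_connected_carrier: "path_connected (carrier G)"
  unfolding path_connected_def
  using path_connected_if_simply_connected[OF simply_connected] by metis

text \<open>Take the imaginary part of a logarithm of \<open>polar_complex\<close> along the covering, normalized at the
  identity.\<close>

lemma milnor_angle_exists: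
  "\<exists>\<Theta>. \<Theta> \<in> extensional (carrier G) \<and> continuous_on (carrier G) \<Theta> \<and>
     \<Theta> \<one> = 0 \<and> (\<forall>x \<in> carrier G. rot (\<Theta> x) = rotation_part (p x))"
proof -
  have pc: "continuous_on (carrier G) p" using covering by (rule covering_space_imp_continuous)
  have nz: "polar_complex (p x) \<noteq> 0" if "x \<in> carrier G" for x
    using that det_p polar_complex_nonzero by blast
  have "continuous_on (carrier G) (\<lambda>x. polar_complex (p x))"
    unfolding polar_complex_def Complex_eq by (intro continuous_intros pc)
  then obtain g where g: "continuous_on (carrier G) g" "\<And>x. x \<in> carrier G \<Longrightarrow> exp (g x) = polar_complex (p x)"
    using continuous_logarithm_on_simply_connected_space[OF simply_connected
        locally_path_connected_covering_space[OF covering locally_path_connected_SL2R], of "\<lambda>x. polar_complex (p x)"] nz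
    by blast
  have cis: "cis (Im (g x)) = sgn (polar_complex (p x))" if "x \<in> carrier G" for x
  proof -
    have "polar_complex (p x) = of_real (exp (Re (g x))) * cis (Im (g x))"
      using g(2)[OF that] exp_eq_polar[of "g x"] by simp
    then show ?thesis by (simp only: sgn_mult sgn_cis sgn_of_real) simp
  qed
  have cis1: "cis (Im (g \<one>)) = 1"
  proof -
    have "polar_complex (mat 1) = 2"
      by (simp add: polar_complex_def mat_1_2_nth complex_eq_iff)
    moreover have "sgn (2::complex) = 1"
      by (simp add: sgn_div_norm complex_eq_iff)
    ultimately show ?thesis using cis[of \<one>] by (simp add: p_one)
  qed
  define \<Theta> where "\<Theta> = restrict (\<lambda>x. Im (g x) - Im (g \<one>)) (carrier G)"
  have "continuous_on (carrier G) (\<lambda>x. Im (g x) - Im (g \<one>))" by (intro continuous_intros g)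
  then have "continuous_on (carrier G) \<Theta>"
    by (rule continuous_on_eq) (simp add: \<Theta>_def)
  moreover have "rot (\<Theta> x) = rotation_part (p x)" if "x \<in> carrier G" for x
    using that cis cis1 by (simp add: rot_eq_rotation_part_iff[OF det_p] \<Theta>_def flip: cis_divide)
  ultimately show ?thesis by (intro exI[of _ \<Theta>]) (auto simp: \<Theta>_def)
qed

text \<open>Along a path from the identity the difference of two candidates is continuous, starts at 0 and is a
  multiple of \<open>2 * pi\<close>.\<close>

lemma milnor_angle_unique:
  assumes \<Theta>: "\<Theta> \<in> extensional (carrier G)" "continuous_on (carrier G) \<Theta>"
     "\<Theta> \<one> = 0" "\<And>x. x \<in> carrier G \<Longrightarrow> rot (\<Theta> x) = rotation_part (p x)"
   and \<Theta>': "\<Theta>' \<in> extensional (carrier G)" "continuous_on (carrier G) \<Theta>'"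
     "\<Theta>' \<one> = 0" "\<And>x. x \<in> carrier G \<Longrightarrow> rot (\<Theta>' x) = rotation_part (p x)"
  shows "\<Theta> = \<Theta>'"
proof (rule extensionalityI[OF \<Theta>(1) \<Theta>'(1)])
  fix x assume x: "x \<in> carrier G"
  obtain \<gamma> where \<gamma>: "path \<gamma>" "path_image \<gamma> \<subseteq> carrier G" "pathstart \<gamma> = \<one>" "pathfinish \<gamma> = x"
    using path_connected_carrier x unfolding path_connected_def by (metis one_closed)
  have \<gamma>G: "\<gamma> t \<in> carrier G" if "t \<in> {0..1}" for t using \<gamma>(2) that by (auto simp: path_image_def)
  let ?D = "\<lambda>t. \<Theta> (\<gamma> t) - \<Theta>' (\<gamma> t)"
  have c: "cis (?D t) = 1" if "t \<in> {0..1}" for t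
  proof -
    have "cis (\<Theta> (\<gamma> t)) = cis (\<Theta>' (\<gamma> t))"
      using \<Theta>(4) \<Theta>'(4) \<gamma>G[OF that] by (metis rot_eq_rotation_part_iff det_p)
    then show ?thesis by (simp flip: cis_divide)
  qed
  have "\<bar>?D 1\<bar> < pi / 2"
  proof (rule abs_less_pi_half_if_cos_pos_on)
    show "continuous_on {0..1} ?D"
      using \<gamma>(1) \<gamma>G unfolding path_def
      by (intro continuous_intros continuous_on_compose2[OF \<Theta>(2)] continuous_on_compose2[OF \<Theta>'(2)]) auto
    show "?D 0 = 0" using \<gamma>(3) \<Theta>(3) \<Theta>'(3) by (simp add: pathstart_def)
    show "cos (?D t) > 0" if "t \<in> {0..1}" for t
      using arg_cong[OF c[OF that], of Re] by simp
  qed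
  moreover have "sin (?D 1) = 0" using arg_cong[OF c[of 1], of Im] by simp
  ultimately have "?D 1 = 0" using sin_eq_0_pi[of "?D 1"] by linarith
  then show "\<Theta> x = \<Theta>' x" using \<gamma>(4) by (simp add: pathfinish_def)
qed

lemma
  shows continuous_on_milnor_angle: "continuous_on (carrier G) (milnor_angle G p)"
    and milnor_angle_one: "milnor_angle G p \<one> = 0"
    and cis_milnor_angle: "\<And>x. x \<in> carrier G \<Longrightarrow> cis (milnor_angle G p x) = sgn (polar_complex (p x))"
proof -
  have "\<exists>!\<Theta>. \<Theta> \<in> extensional (carrier G) \<and> continuous_on (carrier G) \<Theta> \<and>
     \<Theta> \<one> = 0 \<and> (\<forall>x \<in> carrier G. rot (\<Theta> x) = rotation_part (p x))"
    by (rule ex_ex1I[OF milnor_angle_exists]) (elim conjE, rule milnor_angle_unique; simp)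
  from theI'[OF this, folded milnor_angle_def]
  show "continuous_on (carrier G) (milnor_angle G p)" "milnor_angle G p \<one> = 0"
    "\<And>x. x \<in> carrier G \<Longrightarrow> cis (milnor_angle G p x) = sgn (polar_complex (p x))"
    by (auto simp: rot_eq_rotation_part_iff det_p)
qed

lemma cis_milnor_angle_defect:
  assumes "a \<in> carrier G" "b \<in> carrier G"
  shows "cis (milnor_angle G p (b \<otimes> a) - milnor_angle G p b - milnor_angle G p a)
    = cis (- edge_sum \<i> (mobius (p b) \<i>) (mobius (p b) (mobius (p a) \<i>)))"
proof -
  let ?u = "mobius (p b) \<i>" and ?w = "mobius (p b) (mobius (p a) \<i>)"
  have pos: "Im \<i> > 0" "Im ?u > 0" "Im ?w > 0"
    using assms by (auto intro!: Im_mobius_pos simp: det_p)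
  have "cis (milnor_angle G p (b \<otimes> a)) * cis (edge_sum \<i> ?u ?w) = cis (milnor_angle G p b) * cis (milnor_angle G p a)"
    using assms sgn_polar_complex_mult[OF det_p[OF assms(1)] det_p[OF assms(2)]]
    by (simp only: cis_milnor_angle m_closed p_mult cis_edge_sum[OF pos])
  then have "cis (milnor_angle G p (b \<otimes> a)) = cis (milnor_angle G p b) * cis (milnor_angle G p a) / cis (edge_sum \<i> ?u ?w)"
    by (simp add: eq_divide_eq)
  then have "cis (milnor_angle G p (b \<otimes> a)) / cis (milnor_angle G p b) / cis (milnor_angle G p a) = inverse (cis (edge_sum \<i> ?u ?w))"
    by (simp add: field_simps)
  then show ?thesis by (simp only: cis_divide cis_inverse)
qed

text \<open>By \<open>cis_milnor_angle_defect\<close> the cosine of the defect is that of an edge sum, hence positive, along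
  the whole of a path from the identity to \<open>a\<close> and a path from the identity to \<open>b\<close>.\<close>

lemma milnor_angle_defect_bound:
  assumes a: "a \<in> carrier G" and b: "b \<in> carrier G"
  shows "\<bar>milnor_angle G p (b \<otimes> a) - milnor_angle G p b - milnor_angle G p a\<bar> < pi / 2"
proof -
  let ?M = "milnor_angle G p"
  obtain \<gamma> where \<gamma>: "path \<gamma>" "path_image \<gamma> \<subseteq> carrier G" "pathstart \<gamma> = \<one>" "pathfinish \<gamma> = a"
    using path_connected_carrier a unfolding path_connected_def by (metis one_closed)
  obtain \<delta> where \<delta>: "path \<delta>" "path_image \<delta> \<subseteq> carrier G" "pathstart \<delta> = \<one>" "pathfinish \<delta> = b"
    using path_connected_carrier b unfolding path_connected_def by (metis one_closed)
  have G: "\<gamma> t \<in> carrier G" "\<delta> t \<in> carrier G" if "t \<in> {0..1}" for t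
    using \<gamma>(2) \<delta>(2) that by (auto simp: path_image_def)
  let ?D = "\<lambda>t. ?M (\<delta> t \<otimes> \<gamma> t) - ?M (\<delta> t) - ?M (\<gamma> t)"
  have "\<bar>?D 1\<bar> < pi / 2"
  proof (rule abs_less_pi_half_if_cos_pos_on)
    have c: "continuous_on {0..1} \<gamma>" "continuous_on {0..1} \<delta>" using \<gamma>(1) \<delta>(1) by (simp_all add: path_def)
    have "continuous_on {0..1} (\<lambda>t. (\<lambda>(x, y). x \<otimes> y) (\<delta> t, \<gamma> t))"
      by (rule continuous_on_compose2[OF continuous_mult]) (use G c in \<open>auto intro!: continuous_intros\<close>)
    then have "continuous_on {0..1} (\<lambda>t. \<delta> t \<otimes> \<gamma> t)" by simp
    then show "continuous_on {0..1} ?D"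
      using c G by (intro continuous_intros continuous_on_compose2[OF continuous_on_milnor_angle]) auto
    show "?D 0 = 0" using \<gamma>(3) \<delta>(3) by (simp add: pathstart_def milnor_angle_one)
    show "cos (?D t) > 0" if t: "t \<in> {0..1}" for t
    proof -
      let ?E = "edge_sum \<i> (mobius (p (\<delta> t)) \<i>) (mobius (p (\<delta> t)) (mobius (p (\<gamma> t)) \<i>))"
      have "\<bar>?E\<bar> < pi / 2"
        using G[OF t] by (intro edge_sum_bound Im_mobius_pos) (auto simp: det_p)
      then have "cos ?E > 0" by (intro cos_gt_zero_pi) auto
      then show ?thesis using arg_cong[OF cis_milnor_angle_defect[OF G[OF t]], of Re] by simp
    qed
  qed
  then show ?thesis using \<gamma>(4) \<delta>(4) by (simp add: pathfinish_def)
qed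

end

theorem mainTheorem5:
  fixes G :: "('g::topological_space, 'm) monoid_scheme" and p :: "'g \<Rightarrow> real^2^2" and a b :: 'g
  assumes "universal_cover_SL2R G p"
    and "a \<in> carrier G" and "b \<in> carrier G"
  shows "milnor_angle G p (b \<otimes>\<^bsub>G\<^esub> a) =
      milnor_angle G p b + milnor_angle G p a
        - 1 / 2 * signed_area \<i> (mobius (p b) \<i>) ((mobius (p b) \<circ> mobius (p a)) \<i>)
    \<and> \<bar>milnor_angle G p (b \<otimes>\<^bsub>G\<^esub> a) - milnor_angle G p b - milnor_angle G p a\<bar> < pi / 2"
proof -
  interpret universal_cover_SL2R G p by (rule assms(1))
  let ?u = "mobius (p b) \<i>" and ?w = "mobius (p b) (mobius (p a) \<i>)"
  let ?D = "milnor_angle G p (b \<otimes>\<^bsub>G\<^esub> a) - milnor_angle G p b - milnor_angle G p a"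
  have pos: "Im \<i> > 0" "Im ?u > 0" "Im ?w > 0"
    using assms(2,3) by (auto intro!: Im_mobius_pos simp: det_p)
  have D: "\<bar>?D\<bar> < pi / 2" using assms(2,3) by (rule milnor_angle_defect_bound)
  have E: "\<bar>edge_sum \<i> ?u ?w\<bar> < pi / 2" by (rule edge_sum_bound[OF pos])
  have sin: "sin ?D = sin (- edge_sum \<i> ?u ?w)"
    using arg_cong[OF cis_milnor_angle_defect[OF assms(2,3)], of Im] by simp
  have "?D = - edge_sum \<i> ?u ?w"
    by (rule sin_inj_pi[OF _ _ _ _ sin]) (use D E in linarith)+
  then show ?thesis
    using D signed_area_eq_edge_sum[OF pos] by simp
qed

end
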